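(* There is an absolute constant $C'>0$ such that the following holds for every integer $n\ge 2$. Let $A,B$ be distinct subsets of $[n]$ that are each $n^{1/3}$-separated. Then there is some prime $p\in\left[\tfrac12 C'n^{1/3}\log^6 n,\; C'n^{1/3}\log^6 n\right]$ and some $i\in\{0,1,\dots,p-1\}$ such that $|A_{i,p}|\ne |B_{i,p}|$.
   Context: Write $[n]=\{1,\dots,n\}$. For a real $d>0$, a set $A\subseteq[n]$ is called $d$-separated if $|a-a'|\ge d$ for all $a,a'\in A$ with $a\neq a'$. For a set $A\subseteq[n]$, a prime $p$ and $i\in\{0,\dots,p-1\}$, let $A_{i,p}=\{a\in A: a\equiv i \pmod p\}$. Here $\log$ is the natural logarithm and $\log^6 n=(\log n)^6$. *)

theory Defs
  imports Complex_Main "HOL-Number_Theory.Cong"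
begin

(* The coercion to real avoids truncated subtraction on nat.
   The notion is only meant for d > 0. *)
definition separated :: "real \<Rightarrow> nat set \<Rightarrow> bool" where
  "separated d A \<longleftrightarrow> (\<forall>a\<in>A. \<forall>a'\<in>A. a \<noteq> a' \<longrightarrow> \<bar>real a - real a'\<bar> \<ge> d)"

definition residue_part :: "nat set \<Rightarrow> nat \<Rightarrow> nat \<Rightarrow> nat set" where
  "residue_part A i p = {a \<in> A. [a = i] (mod p)}"

end

theory Submission
  imports Defs "HOL-Complex_Analysis.Complex_Analysis" "HOL-Real_Asymp.Real_Asymp"
begin

text \<open>
  Suppose that \<open>A\<close> and \<open>B\<close> have the same residue counts modulo every prime of the interval, and let
  \<open>r\<close> be the least element of their symmetric difference. The difference of their generating
  functions, divided by \<open>z ^ r\<close>, is up to sign \<open>f z = 1 - \<sigma> * z ^ d + \<dots>\<close> with \<open>\<sigma> \<in> {0, 1}\<close> and all further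
  exponents at least \<open>N = n powr (1/3)\<close>. For each \<open>k\<close> the signed sum of the \<open>k\<close>-th falling factorials
  of \<open>a - r\<close> is an integer divisible by the product of all these primes. That product is larger than
  the sum as long as \<open>k < K\<close>, where \<open>K\<close> is a large multiple of \<open>N * (ln n)\<^sup>2\<close>, so \<open>f\<close> vanishes at 1 to
  order \<open>K\<close>.

  This is impossible. Let \<open>h\<close> be a self-map of the disc with \<open>h 0 = 0\<close> whose boundary values satisfy
  \<open>1 - \<bar>h (cis t)\<bar> \<ge> \<bar>t\<bar> / (8 * pi)\<close> down to the scale \<open>\<bar>t\<bar> \<approx> 1 / n\<close> and
  \<open>\<bar>1 - h (cis t)\<bar> = O(1 / n + \<bar>t\<bar> * ln n)\<close>. Then
  \<open>\<Phi> = (f \<circ> h) / (1 - \<sigma> * h ^ d)\<close> is holomorphic with \<open>\<Phi> 0 = 1\<close>. On the unit circle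
  it is at most \<open>1 + 1/n\<close> in modulus for \<open>\<bar>t\<bar> \<ge> O(ln n / N)\<close>, at most \<open>n ^ 5\<close> everywhere, and at most
  \<open>exp (O(N * ln n) - K)\<close> for \<open>\<bar>t\<bar> \<le> O(1 / N\<^sup>2)\<close> because of the zero of \<open>f\<close>. Multiplying about \<open>N\<^sup>2\<close>
  rotated copies of \<open>\<Phi>\<close>, each boundary point meets the last range at least once and the middle range
  \<open>O(N * ln n)\<close> times, so the maximum modulus principle gives \<open>1 \<le> exp (O(N * (ln n)\<^sup>2) - K)\<close>.
\<close>

section \<open>Products of primes\<close>

text \<open>Legendre's formula: passing from \<open>n\<close> to \<open>Suc n\<close> raises by one
  exactly the summands with \<open>p ^ i dvd Suc n\<close>. The range may extend to any
  \<open>N \<ge> n\<close>, so that the formulas for \<open>fact M\<close> and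
  \<open>fact (2*M)\<close> can be compared term by term.\<close>

lemma multiplicity_fact_Legendre:
  fixes p :: nat
  assumes p: "prime p" and "n \<le> N"
  shows "multiplicity p (fact n) = (\<Sum>i=1..N. n div p ^ i)"
  using \<open>n \<le> N\<close>
proof (induction n)
  case 0
  then show ?case by simp
next
  case (Suc n)
  define v where "v = multiplicity p (Suc n)"
  have "p ^ v dvd Suc n"
    by (simp add: v_def multiplicity_dvd)
  then have "p ^ v \<le> Suc n"
    by (rule dvd_imp_le) simp
  moreover have "v < p ^ v"
    using p by (simp add: power_gt_expt prime_gt_Suc_0_nat)
  ultimately have "v \<le> N" using Suc.prems by linarith
  have dvd_iff: "p ^ i dvd Suc n \<longleftrightarrow> i \<le> v" for i
    unfolding v_def using p by (intro power_dvd_iff_le_multiplicity) auto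
  have "Suc n div p ^ i = n div p ^ i + (if i \<le> v then 1 else 0)" for i
    using dvd_iff[of i] by (simp add: div_Suc dvd_eq_mod_eq_0)
  then have "(\<Sum>i=1..N. Suc n div p ^ i)
      = (\<Sum>i=1..N. n div p ^ i) + (\<Sum>i=1..N. if i \<le> v then 1 else 0)"
    by (simp add: sum.distrib)
  also have "(\<Sum>i=1..N. if i \<le> v then 1 else 0 :: nat) = v"
  proof -
    have "{i \<in> {1..N}. i \<le> v} = {1..v}" using \<open>v \<le> N\<close> by auto
    then show ?thesis by (simp add: sum.If_cases Int_def)
  qed
  finally have "(\<Sum>i=1..N. Suc n div p ^ i) = (\<Sum>i=1..N. n div p ^ i) + v" .
  moreover have "multiplicity p (fact (Suc n) :: nat) = v + multiplicity p (fact n :: nat)"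
    unfolding fact_Suc v_def of_nat_id using p
    by (subst prime_elem_multiplicity_mult_distrib) (simp_all del: mult_Suc)
  ultimately show ?case using Suc by simp
qed

section \<open>Prime exponents in the central binomial coefficient\<close>

lemma multiplicity_central_binomial:
  fixes p :: nat
  assumes p: "prime p"
  shows "multiplicity p ((2*M) choose M) + (\<Sum>i=1..2*M. 2 * (M div p ^ i))
           = (\<Sum>i=1..2*M. 2 * M div p ^ i)"
proof -
  have "fact (2*M) = fact M * fact M * ((2*M) choose M)"
    using binomial_fact_lemma[of M "2*M"] by (simp add: mult_2)
  then have "multiplicity p (fact (2*M) :: nat)
      = 2 * multiplicity p (fact M :: nat) + multiplicity p ((2*M) choose M)"
    using p by (simp add: prime_elem_multiplicity_mult_distrib)
  then show ?thesis
    using multiplicity_fact_Legendre[OF p, of M "2*M"] multiplicity_fact_Legendre[OF p, of "2*M" "2*M"]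
    by (simp add: sum_distrib_left)
qed

lemma double_div_le: "2 * M div q \<le> 2 * (M div q) + (if q \<le> 2 * M then 1 else 0)" for M q :: nat
proof (cases "q \<le> 2 * M \<and> q > 0")
  case True
  have "M = q * (M div q) + M mod q" by simp
  moreover have "M mod q < q" using True by simp
  ultimately have "2 * M < 2 * (q * (M div q)) + 2 * q" by linarith
  then have "2 * M < q * (2 * (M div q) + 2)" by (simp add: algebra_simps)
  then have "2 * M div q < 2 * (M div q) + 2"
    using True by (simp add: div_less_iff_less_mult mult.commute)
  then show ?thesis using True by simp
qed auto

text \<open>By Legendre's formula the exponent \<open>v\<close> is at most the number of
  \<open>i \<ge> 1\<close> with \<open>p ^ i \<le> 2 * M\<close>. If \<open>p ^ v\<close> exceeded
  \<open>2 * M\<close>, only the \<open>v - 1\<close> indices below \<open>v\<close> could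
  count.\<close>

lemma power_multiplicity_central_binomial_le:
  fixes p :: nat
  assumes p: "prime p" and "M > 0"
  shows "p ^ multiplicity p ((2*M) choose M) \<le> 2 * M"
proof -
  define v where "v = multiplicity p ((2*M) choose M)"
  have "v + (\<Sum>i=1..2*M. 2 * (M div p ^ i))
      \<le> (\<Sum>i=1..2*M. 2 * (M div p ^ i)) + (\<Sum>i=1..2*M. if p ^ i \<le> 2 * M then 1 else 0)"
    unfolding v_def multiplicity_central_binomial[OF p] sum.distrib[symmetric]
    by (intro sum_mono double_div_le)
  then have "v \<le> card {i \<in> {1..2*M}. p ^ i \<le> 2 * M}"
    by (simp add: sum.If_cases Int_def)
  show ?thesis
  proof (rule ccontr)
    assume "\<not> ?thesis"
    then have "2 * M < p ^ v" by (simp add: v_def)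
    have "i < v" if "p ^ i \<le> 2 * M" for i
    proof (rule ccontr)
      assume "\<not> i < v"
      then have "p ^ v \<le> p ^ i" using p by (intro power_increasing) (auto simp: prime_gt_0_nat Suc_le_eq)
      then show False using that \<open>2 * M < p ^ v\<close> by linarith
    qed
    then have "{i \<in> {1..2*M}. p ^ i \<le> 2 * M} \<subseteq> {1..<v}" by auto
    then have "card {i \<in> {1..2*M}. p ^ i \<le> 2 * M} \<le> v - 1"
      using card_mono[of "{1..<v}"] by simp
    moreover have "v > 0"
      using \<open>2 * M < p ^ v\<close> \<open>M > 0\<close> by (cases v) auto
    ultimately show False using \<open>v \<le> card _\<close> by linarith
  qed
qed

lemma multiplicity_central_binomial_le_1:
  fixes p :: nat
  assumes "prime p" and "M > 0" and "2 * M < p * p"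
  shows "multiplicity p ((2*M) choose M) \<le> 1"
proof (rule ccontr)
  assume "\<not> ?thesis"
  then have "p ^ 2 \<le> p ^ multiplicity p ((2*M) choose M)"
    using assms by (intro power_increasing) (auto simp: prime_gt_0_nat Suc_le_eq)
  with power_multiplicity_central_binomial_le[of p M] assms show False
    by (simp add: power2_eq_square)
qed

text \<open>Such a prime divides \<open>fact (2*M)\<close> exactly twice and each of the two factors
  \<open>fact M\<close> once, so it cancels; higher powers of it exceed
  \<open>2 * M\<close>.\<close>

lemma multiplicity_central_binomial_eq_0:
  fixes p :: nat
  assumes p: "prime p" and "p \<le> M" and "2 * M < 3 * p" and "2 * M < p * p"
  shows "multiplicity p ((2*M) choose M) = 0"
proof -
  have "2 * M div p ^ i \<le> 2 * (M div p ^ i)" if "i \<ge> 1" for i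
  proof (cases "i = 1")
    case True
    have "2 * M div p < 3"
      using assms by (simp add: div_less_iff_less_mult prime_gt_0_nat)
    moreover have "M div p \<ge> 1"
      using assms by (simp add: Suc_le_eq div_greater_zero_iff prime_gt_0_nat)
    ultimately show ?thesis using True by simp
  next
    case False
    with that have "p ^ 2 \<le> p ^ i"
      using p by (intro power_increasing) (auto simp: prime_gt_0_nat Suc_le_eq)
    then have "2 * M < p ^ i" using assms by (simp add: power2_eq_square)
    then show ?thesis by simp
  qed
  then have "(\<Sum>i=1..2*M. 2 * M div p ^ i) \<le> (\<Sum>i=1..2*M. 2 * (M div p ^ i))"
    by (intro sum_mono) simp
  then show ?thesis using multiplicity_central_binomial[OF p, of M] by linarith
qed

section \<open>Chebyshev-type bounds for products of primes\<close>

lemma prod_primes_dvd: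
  fixes m :: "'a :: factorial_semiring_gcd"
  assumes "finite S" and "\<And>p. p \<in> S \<Longrightarrow> prime p" and "\<And>p. p \<in> S \<Longrightarrow> p dvd m"
  shows "\<Prod>S dvd m"
  using assms
proof (induction S rule: finite_induct)
  case (insert q S)
  have "coprime q (\<Prod>S)"
  proof (rule prod_coprime_right)
    fix p assume "p \<in> S"
    then show "coprime q p" using insert by (intro primes_coprime) auto
  qed
  then have "q * \<Prod>S dvd m" using insert by (intro divides_mult) auto
  then show ?case using insert by simp
qed simp

text \<open>Strong induction. An even \<open>n > 2\<close> adds no prime. For
  \<open>n = 2 * m + 1\<close> the primes above \<open>m + 1\<close> all divide
  \<open>(2 * m + 1) choose m\<close>, which is at most half of the row sum
  \<open>2 ^ (2 * m + 1)\<close>; the remaining primes are covered by the induction hypothesis for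
  \<open>m + 1\<close>.\<close>

lemma primorial_le: "\<Prod>{p. prime p \<and> p \<le> n} \<le> 4 ^ n" for n :: nat
proof (induction n rule: less_induct)
  case (less n)
  have fin: "finite {p::nat. prime p \<and> p \<le> k}" for k
    by (rule finite_subset[of _ "{..k}"]) auto
  consider "n = 0" | "n = 1" | "n = 2" | "n > 2" "even n" | m where "n = 2 * m + 1" "m > 0"
  proof -
    have "n = 0 \<or> n = 1 \<or> n = 2 \<or> (n > 2 \<and> even n) \<or> (odd n \<and> n \<noteq> 1)" by (cases "even n") auto
    then show thesis using that by (auto elim!: oddE)
  qed
  then show ?case
  proof cases
    case 1
    then have *: "{p::nat. prime p \<and> p \<le> n} = {}" by (auto simp: prime_gt_0_nat)
    show ?thesis unfolding * by simp
  next
    case 2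
    then have *: "{p::nat. prime p \<and> p \<le> n} = {}" by (auto dest: prime_ge_2_nat)
    show ?thesis unfolding * by simp
  next
    case 3
    have "p = 2" if "prime p" "p \<le> 2" for p :: nat
      using prime_ge_2_nat[OF that(1)] that(2) by linarith
    then have *: "{p::nat. prime p \<and> p \<le> n} = {2}" using 3 by auto
    show ?thesis unfolding * using 3 by simp
  next
    case 4
    have "p \<le> n \<longleftrightarrow> p \<le> n - 1" if "prime p" for p :: nat
    proof -
      have "p \<noteq> n" using 4 prime_odd_nat[OF that] by auto
      then show ?thesis using 4 by linarith
    qed
    then have *: "{p::nat. prime p \<and> p \<le> n} = {p. prime p \<and> p \<le> n - 1}"
      by (intro Collect_cong conj_cong refl)
    have "\<Prod>{p::nat. prime p \<and> p \<le> n} \<le> 4 ^ (n - 1)"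
      unfolding * by (rule less) (use 4 in simp)
    also have "\<dots> \<le> 4 ^ n" by (intro power_increasing) auto
    finally show ?thesis .
  next
    case 5
    define T where "T = {p::nat. prime p \<and> m + 1 < p \<and> p \<le> n}"
    have "finite T" using fin[of n] by (rule rev_finite_subset) (auto simp: T_def)
    have "p dvd (2 * m + 1) choose m" if "p \<in> T" for p
    proof -
      have "p dvd fact (2 * m + 1)"
        using that 5 unfolding T_def by (subst prime_dvd_fact_iff) auto
      also have "fact (2 * m + 1) = fact m * fact (m + 1) * ((2 * m + 1) choose m)"
        using binomial_fact_lemma[of m "2 * m + 1"] by simp
      finally have dvd: "p dvd fact m * fact (m + 1) * ((2 * m + 1) choose m)" .
      have p: "prime p" "\<not> p \<le> m" "\<not> p \<le> m + 1" using that by (auto simp: T_def)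
      then have "\<not> p dvd fact m" "\<not> p dvd fact (m + 1)"
        by (simp_all only: prime_dvd_fact_iff not_False_eq_True)
      then show ?thesis using dvd p(1) by (metis prime_dvd_multD)
    qed
    then have "\<Prod>T dvd (2 * m + 1) choose m"
      using \<open>finite T\<close> by (intro prod_primes_dvd) (auto simp: T_def)
    then have "\<Prod>T \<le> (2 * m + 1) choose m" by (rule dvd_imp_le) simp
    also have "\<dots> \<le> (\<Sum>k\<le>m. (2 * m + 1) choose k)"
      by (rule member_le_sum) auto
    also have "\<dots> = 4 ^ m" by (simp only: binomial_r_part_sum power_mult) simp
    finally have T: "\<Prod>T \<le> 4 ^ m" .
    have "p \<le> m + 1 \<Longrightarrow> p \<le> n" for p using 5 by linarith
    then have un: "{p::nat. prime p \<and> p \<le> n} = {p. prime p \<and> p \<le> m + 1} \<union> T"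
      unfolding T_def by force
    have "\<Prod>{p::nat. prime p \<and> p \<le> n} = \<Prod>{p. prime p \<and> p \<le> m + 1} * \<Prod>T"
      unfolding un using fin \<open>finite T\<close>
      by (intro prod.union_disjoint) (auto simp: T_def)
    also have "\<dots> \<le> 4 ^ (m + 1) * 4 ^ m"
      using 5 less[of "m + 1"] T by (intro mult_mono) auto
    also have "\<dots> = 4 ^ n" using 5 by (simp add: power_add mult_2)
    finally show ?thesis .
  qed
qed

text \<open>
  Erdos's argument: apart from the primes in \<open>(M, 2 * M]\<close>, only primes up to \<open>2 * M / 3\<close> divide the
  central binomial coefficient, and only those up to \<open>sqrt (2 * M)\<close> can do so more than once.
\<close>

lemma central_binomial_le_prod_primes:
  assumes "M > 0"
  shows "real ((2*M) choose M)
     \<le> (2 * real M) powr sqrt (2 * real M) * 4 powr (2 * real M / 3)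
        * real (\<Prod>{p. prime p \<and> M < p \<and> p \<le> 2 * M})"
proof -
  let ?v = "\<lambda>p. multiplicity p ((2*M) choose M)"
  define P where "P = {p::nat. prime p \<and> p \<le> 2 * M}"
  \<comment> \<open>\<open>S1\<close> has at most \<open>sqrt (2 * M)\<close> primes, each with
    prime power at most \<open>2 * M\<close>. On \<open>S2\<close> and \<open>S4\<close> exponents
    are at most 1, and on \<open>S3\<close> they are 0. The primorial bound applies to
    \<open>S2\<close>, and \<open>S4\<close> is what is to be bounded below.\<close>
  define S1 where "S1 = {p \<in> P. p * p \<le> 2 * M}"
  define S2 where "S2 = {p \<in> P. 2 * M < p * p \<and> 3 * p \<le> 2 * M}"
  define S3 where "S3 = {p \<in> P. 2 * M < p * p \<and> 2 * M < 3 * p \<and> p \<le> M}"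
  define S4 where "S4 = {p \<in> P. M < p \<and> 2 * M < p * p}"
  have "finite P" unfolding P_def by (rule finite_subset[of _ "{..2*M}"]) auto
  then have fin: "finite S1" "finite S2" "finite S3" "finite S4"
    by (auto simp: S1_def S2_def S3_def S4_def)
  have "(2*M) choose M = (\<Prod>p\<in>P. p ^ ?v p)"
  proof -
    have "(2*M) choose M = (\<Prod>p\<in>prime_factors ((2*M) choose M). p ^ ?v p)"
      by (rule prime_factorization_nat) simp
    also have "\<dots> = (\<Prod>p\<in>P. p ^ ?v p)"
    proof (rule prod.mono_neutral_left)
      show "prime_factors ((2*M) choose M) \<subseteq> P"
      proof
        fix p assume "p \<in> prime_factors ((2*M) choose M)"
        then have p: "prime p" "p dvd (2*M) choose M" by (auto simp: in_prime_factors_iff)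
        have "(2*M) choose M dvd fact (2*M)"
          by (metis binomial_fact_lemma dvd_triv_right le_add1 mult_2)
        then have "p dvd fact (2*M)" using p by auto
        then show "p \<in> P" using p by (simp add: P_def prime_dvd_fact_iff)
      qed
      show "\<forall>p\<in>P - prime_factors ((2*M) choose M). p ^ ?v p = 1"
        by (auto simp: P_def in_prime_factors_iff not_dvd_imp_multiplicity_0)
    qed (fact \<open>finite P\<close>)
    finally show ?thesis .
  qed
  also have "P = S1 \<union> (S2 \<union> (S3 \<union> S4))"
    by (auto simp: S1_def S2_def S3_def S4_def)
  also have "(\<Prod>p\<in>\<dots>. p ^ ?v p)
      = (\<Prod>p\<in>S1. p ^ ?v p) * ((\<Prod>p\<in>S2. p ^ ?v p) * ((\<Prod>p\<in>S3. p ^ ?v p) * (\<Prod>p\<in>S4. p ^ ?v p)))"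
  proof -
    have "S1 \<inter> (S2 \<union> (S3 \<union> S4)) = {}" "S2 \<inter> (S3 \<union> S4) = {}" "S3 \<inter> S4 = {}"
      by (auto simp: S1_def S2_def S3_def S4_def)
    with fin show ?thesis by (simp add: prod.union_disjoint)
  qed
  finally have "real ((2*M) choose M) = real ((\<Prod>p\<in>S1. p ^ ?v p) * ((\<Prod>p\<in>S2. p ^ ?v p)
      * ((\<Prod>p\<in>S3. p ^ ?v p) * (\<Prod>p\<in>S4. p ^ ?v p))))"
    by (rule arg_cong)
  then have split: "real ((2*M) choose M)
      = real (\<Prod>p\<in>S1. p ^ ?v p) * (real (\<Prod>p\<in>S2. p ^ ?v p)
         * (real (\<Prod>p\<in>S3. p ^ ?v p) * real (\<Prod>p\<in>S4. p ^ ?v p)))"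
    by (simp only: of_nat_mult)
  have le1: "p ^ ?v p \<le> p" if "prime p" "2 * M < p * p" for p :: nat
    using power_increasing[OF multiplicity_central_binomial_le_1[OF that(1) assms that(2)], of p]
      prime_ge_1_nat[OF that(1)] by simp
  have B1: "real (\<Prod>p\<in>S1. p ^ ?v p) \<le> (2 * real M) powr sqrt (2 * real M)"
  proof -
    have "(\<Prod>p\<in>S1. p ^ ?v p) \<le> (\<Prod>p\<in>S1. 2 * M)"
      using assms by (intro prod_mono) (auto simp: S1_def P_def power_multiplicity_central_binomial_le)
    then have "real (\<Prod>p\<in>S1. p ^ ?v p) \<le> real ((2 * M) ^ card S1)"
      by (subst of_nat_le_iff) simp
    also have "\<dots> = (2 * real M) powr real (card S1)"
      using assms by (simp add: powr_realpow)
    also have "\<dots> \<le> (2 * real M) powr sqrt (2 * real M)"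
    proof (rule powr_mono)
      have "S1 \<subseteq> {1..nat \<lfloor>sqrt (2 * real M)\<rfloor>}"
      proof
        fix p assume "p \<in> S1"
        then have "p * p \<le> 2 * M" "p \<ge> 1" by (auto simp: S1_def P_def prime_gt_0_nat Suc_le_eq)
        then have "real p * real p \<le> 2 * real M"
          by (metis of_nat_le_iff of_nat_mult of_nat_numeral)
        then have "real p \<le> sqrt (2 * real M)"
          by (intro real_le_rsqrt) (simp add: power2_eq_square)
        then have "p \<le> nat \<lfloor>sqrt (2 * real M)\<rfloor>" by (rule le_nat_floor)
        then show "p \<in> {1..nat \<lfloor>sqrt (2 * real M)\<rfloor>}"
          using \<open>p \<ge> 1\<close> by simp
      qed
      then have "card S1 \<le> nat \<lfloor>sqrt (2 * real M)\<rfloor>"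
        using card_mono[OF finite_atLeastAtMost] by (metis card_atLeastAtMost diff_Suc_1)
      then show "real (card S1) \<le> sqrt (2 * real M)"
        by (meson of_nat_0_le_iff of_nat_floor of_nat_mono order_trans real_sqrt_ge_zero
            mult_nonneg_nonneg zero_le_numeral)
    qed (use assms in simp)
    finally show ?thesis .
  qed
  have B2: "real (\<Prod>p\<in>S2. p ^ ?v p) \<le> 4 powr (2 * real M / 3)"
  proof -
    define k where "k = 2 * M div 3"
    have "finite {p::nat. prime p \<and> p \<le> k}" by (rule finite_subset[of _ "{..k}"]) auto
    have "(\<Prod>p\<in>S2. p ^ ?v p) \<le> \<Prod>S2"
      by (intro prod_mono) (auto simp: S2_def P_def le1)
    also have "\<dots> \<le> \<Prod>{p. prime p \<and> p \<le> k}"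
    proof (rule dvd_imp_le)
      show "\<Prod>S2 dvd \<Prod>{p. prime p \<and> p \<le> k}"
        by (rule prod_dvd_prod_subset[OF \<open>finite {p. prime p \<and> p \<le> k}\<close>])
          (auto simp: S2_def P_def k_def)
    qed (auto intro!: prod_pos simp: prime_gt_0_nat)
    also have "\<dots> \<le> 4 ^ k" by (rule primorial_le)
    finally have "real (\<Prod>p\<in>S2. p ^ ?v p) \<le> 4 ^ k" by (metis of_nat_le_iff of_nat_numeral of_nat_power)
    also have "\<dots> = 4 powr real k" by (simp add: powr_realpow)
    also have "\<dots> \<le> 4 powr (2 * real M / 3)" by (rule powr_mono) (auto simp: k_def)
    finally show ?thesis .
  qed
  have B3: "real (\<Prod>p\<in>S3. p ^ ?v p) = 1"
    by (auto intro!: prod.neutral simp: S3_def P_def multiplicity_central_binomial_eq_0)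
  have B4: "real (\<Prod>p\<in>S4. p ^ ?v p) \<le> real (\<Prod>{p. prime p \<and> M < p \<and> p \<le> 2 * M})"
  proof -
    have "(\<Prod>p\<in>S4. p ^ ?v p) \<le> \<Prod>S4"
      by (intro prod_mono) (auto simp: S4_def P_def le1)
    also have "\<dots> \<le> \<Prod>{p. prime p \<and> M < p \<and> p \<le> 2 * M}"
    proof (rule dvd_imp_le)
      have "finite {p. prime p \<and> M < p \<and> p \<le> 2 * M}" by (rule finite_subset[of _ "{..2*M}"]) auto
      then show "\<Prod>S4 dvd \<Prod>{p. prime p \<and> M < p \<and> p \<le> 2 * M}"
        by (rule prod_dvd_prod_subset) (auto simp: S4_def P_def)
    qed (auto intro!: prod_pos simp: prime_gt_0_nat)
    finally show ?thesis by (rule of_nat_mono)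
  qed
  have "real ((2*M) choose M)
     \<le> (2 * real M) powr sqrt (2 * real M) * (4 powr (2 * real M / 3)
        * (1 * real (\<Prod>{p. prime p \<and> M < p \<and> p \<le> 2 * M})))"
    unfolding split B3 using B1 B2 B4 by (intro mult_mono mult_nonneg_nonneg of_nat_0_le_iff) auto
  then show ?thesis by (simp add: mult.assoc)
qed

text \<open>With \<open>M\<close> the integer part of \<open>x / 2\<close>, the central binomial
  coefficient is at least \<open>4 ^ M / (2 * M)\<close>. Cancelling
  \<open>4 powr (2 * M / 3)\<close> leaves \<open>4 powr (M / 3)\<close>, which is at least
  \<open>exp (x / 6)\<close> up to a constant, against the subexponential loss
  \<open>x * x powr sqrt x\<close>. The rate \<open>1/10\<close> is below \<open>1/6\<close>, hence
  the threshold \<open>x0\<close>.\<close>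

lemma prod_primes_half_interval_ge:
  "\<exists>x0 \<ge> 1. \<forall>x \<ge> x0. exp (x / 10) < real (\<Prod>{p. prime p \<and> x / 2 \<le> real p \<and> real p \<le> x})"
proof -
  have "eventually (\<lambda>x::real. exp (x / 10)
      < exp ((x / 2 - 1) / 3) / (exp (ln x * sqrt x) * x)) at_top"
    by real_asymp
  then obtain x0 where x0: "\<And>x. x \<ge> x0 \<Longrightarrow>
      exp (x / 10) < exp ((x / 2 - 1) / 3) / (exp (ln x * sqrt x) * x)"
    by (auto simp: eventually_at_top_linorder)
  have "exp (x / 10) < real (\<Prod>{p. prime p \<and> x / 2 \<le> real p \<and> real p \<le> x})"
    if "x \<ge> max x0 2" for x
  proof -
    define M where "M = nat \<lfloor>x / 2\<rfloor>"
    have "x \<ge> 2" "x \<ge> x0" using that by auto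
    then have M: "real M \<le> x / 2" "x / 2 - 1 \<le> real M" "M > 0"
      unfolding M_def by (auto simp: of_nat_floor) linarith+
    let ?Q = "\<Prod>{p. prime p \<and> M < p \<and> p \<le> 2 * M}"
    have "4 powr real M / (2 * real M)
        \<le> (2 * real M) powr sqrt (2 * real M) * 4 powr (2 * real M / 3) * real ?Q"
      using central_binomial_lower_bound[OF M(3)] central_binomial_le_prod_primes[OF M(3)]
      by (simp add: powr_realpow)
    also have "\<dots> \<le> x powr sqrt x * 4 powr (2 * real M / 3) * real ?Q"
      using M by (intro mult_right_mono order_trans[OF powr_mono2 powr_mono]) (auto intro: prod_nonneg)
    finally have "4 powr real M / (2 * real M) \<le> x powr sqrt x * 4 powr (2 * real M / 3) * real ?Q" .
    moreover have "4 powr real M = 4 powr (real M / 3) * 4 powr (2 * real M / 3)"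
      by (simp flip: powr_add)
    ultimately have "4 powr (2 * real M / 3) * (4 powr (real M / 3) / (2 * real M))
        \<le> 4 powr (2 * real M / 3) * (x powr sqrt x * real ?Q)"
      by (simp only: mult_ac times_divide_eq_right times_divide_eq_left)
    then have "4 powr (real M / 3) / (2 * real M) \<le> x powr sqrt x * real ?Q"
      by (rule mult_left_le_imp_le) simp
    moreover have "4 powr ((x / 2 - 1) / 3) / x \<le> 4 powr (real M / 3) / (2 * real M)"
      using M \<open>x \<ge> 2\<close> by (intro frac_le powr_mono) auto
    ultimately have "4 powr ((x / 2 - 1) / 3) / x \<le> x powr sqrt x * real ?Q" by linarith
    moreover have "exp ((x / 2 - 1) / 3) \<le> 4 powr ((x / 2 - 1) / 3)"
    proof -
      have "exp (1::real) \<le> 4" using exp_le by linarith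
      then have "1 \<le> ln (4::real)" by (simp add: ln_ge_iff)
      then show ?thesis using \<open>x \<ge> 2\<close> mult_left_mono[of 1 "ln 4" "(x / 2 - 1) / 3"]
        by (simp add: powr_def)
    qed
    ultimately have "exp ((x / 2 - 1) / 3) \<le> x * (x powr sqrt x * real ?Q)"
      using \<open>x \<ge> 2\<close> by (simp add: divide_le_eq mult.commute)
    then have "exp ((x / 2 - 1) / 3) / (exp (ln x * sqrt x) * x) \<le> real ?Q"
      using \<open>x \<ge> 2\<close> by (simp add: powr_def divide_le_eq mult_ac)
    also have "real ?Q \<le> real (\<Prod>{p. prime p \<and> x / 2 \<le> real p \<and> real p \<le> x})"
      unfolding of_nat_le_iff
    proof (rule dvd_imp_le)
      have "finite {p. prime p \<and> x / 2 \<le> real p \<and> real p \<le> x}"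
        by (rule finite_subset[of _ "{..nat \<lfloor>x\<rfloor>}"]) (auto simp: le_nat_floor)
      then show "?Q dvd \<Prod>{p. prime p \<and> x / 2 \<le> real p \<and> real p \<le> x}"
        by (rule prod_dvd_prod_subset) (use M in auto)
    qed (auto intro!: prod_pos simp: prime_gt_0_nat)
    finally show ?thesis using x0[OF \<open>x \<ge> x0\<close>] by linarith
  qed
  then show ?thesis by (intro exI[of _ "max x0 2"]) auto
qed

section \<open>Products of rotated functions\<close>

lemma prod_shift_periodic:
  fixes g :: "nat \<Rightarrow> 'a :: comm_monoid_mult"
  assumes "\<And>j. g (j + m) = g j"
  shows "(\<Prod>j<m. g (j + q)) = (\<Prod>j<m. g j)"
proof (induction q)
  case (Suc q)
  have "(\<Prod>j<m. g (j + Suc q)) = (\<Prod>j<m. g (j + q))"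
  proof (cases m)
    case (Suc m')
    have "g (m' + Suc q) = g q"
      using assms[of q] Suc by (simp add: add_ac)
    then have "(\<Prod>j<Suc m'. g (j + Suc q)) = g q * (\<Prod>j<m'. g (Suc j + q))"
      by (simp add: mult.commute)
    also have "\<dots> = (\<Prod>j<Suc m'. g (j + q))"
      by (simp add: prod.lessThan_Suc_shift del: prod.lessThan_Suc)
    finally show ?thesis using Suc by simp
  qed simp
  with Suc show ?case by simp
qed simp

text \<open>The product \<open>F\<close> of the \<open>m\<close> rotated copies satisfies
  \<open>F 0 = 1\<close>, so the maximum modulus principle bounds 1 by any bound of \<open>F\<close>
  on the circle. There one factor is estimated by \<open>S\<close>, the few others with angle
  possibly within \<open>\<delta>\<close> of a multiple of \<open>2 * pi\<close> by
  \<open>B\<close>, and the rest by \<open>1 + \<eta>\<close>.\<close>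

lemma one_le_prod_rotations_bound:
  fixes \<Phi> :: "complex \<Rightarrow> complex" and m :: nat and B S \<eta> \<delta> :: real
  assumes hol: "\<Phi> holomorphic_on ball 0 1" and cont: "continuous_on (cball 0 1) \<Phi>"
    and "\<Phi> 0 = 1" and "m > 0" and "B \<ge> 1" and "\<eta> \<ge> 0" and "\<delta> \<ge> 0"
    and bound: "\<And>t. norm (\<Phi> (cis t)) \<le> B"
    and far: "\<And>t. \<delta> \<le> \<bar>t\<bar> \<Longrightarrow> \<bar>t\<bar> \<le> pi \<Longrightarrow> norm (\<Phi> (cis t)) \<le> 1 + \<eta>"
    and near: "\<And>t. \<bar>t\<bar> \<le> 2 * pi / m \<Longrightarrow> norm (\<Phi> (cis t)) \<le> S"
  shows "1 \<le> S * (1 + \<eta>) ^ m * B ^ (2 * nat \<lfloor>m * \<delta> / (2 * pi)\<rfloor> + 2)"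
proof -
  define F where "F = (\<lambda>z. \<Prod>j<m. \<Phi> (cis (2 * pi * j / m) * z))"
  define k where "k = nat \<lfloor>m * \<delta> / (2 * pi)\<rfloor> + 1"
  have "norm (F 0) \<le> S * (1 + \<eta>) ^ m * B ^ (2 * k)"
  proof (rule maximum_modulus_frontier[of F "cball 0 1"])
    show "F holomorphic_on interior (cball 0 1)"
      unfolding F_def
      by (auto intro!: holomorphic_on_prod holomorphic_on_compose_gen[OF _ hol, unfolded o_def]
          holomorphic_intros simp: norm_mult)
    show "continuous_on (closure (cball 0 1)) F"
      unfolding F_def
      by (auto intro!: continuous_on_prod continuous_on_compose2[OF cont] continuous_intros
          simp: norm_mult)
    show "norm (F z) \<le> S * (1 + \<eta>) ^ m * B ^ (2 * k)" if "z \<in> frontier (cball 0 1)" for z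
    proof -
      from that have "norm z = 1" by simp
      then have z: "z = cis (Arg2pi z)"
        using Arg2pi_eq[of z] by (simp add: cis_conv_exp)
      \<comment> \<open>Rotating by multiples of \<open>2 * pi / m\<close> only permutes the
        factors, so the angles may be taken as \<open>\<theta> + 2 * pi * j / m\<close> with
        \<open>0 \<le> \<theta> < 2 * pi / m\<close>. The factor \<open>j = 0\<close> then falls
        under \<open>near\<close>.\<close>
      define q where "q = nat \<lfloor>m * Arg2pi z / (2 * pi)\<rfloor>"
      define \<theta> where "\<theta> = Arg2pi z - 2 * pi * q / m"
      have "real q \<le> m * Arg2pi z / (2 * pi)" "m * Arg2pi z / (2 * pi) < real q + 1"
        unfolding q_def using Arg2pi_ge_0[of z] by (auto simp: of_nat_floor)
      then have "2 * pi * q / m \<le> Arg2pi z" "Arg2pi z < 2 * pi * (q + 1) / m"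
        using \<open>m > 0\<close> by (simp_all add: field_simps)
      then have \<theta>: "0 \<le> \<theta>" "\<theta> < 2 * pi / m"
        by (simp_all add: \<theta>_def distrib_left add_divide_distrib)
      define t where "t = (\<lambda>j::nat. \<theta> + 2 * pi * j / m)"
      have "F z = (\<Prod>j<m. \<Phi> (cis (t (j + q))))"
        unfolding F_def
      proof (rule prod.cong[OF refl])
        fix j
        have "2 * pi * j / m + Arg2pi z = t (j + q)"
          by (simp add: t_def \<theta>_def add_divide_distrib distrib_left)
        then show "\<Phi> (cis (2 * pi * j / m) * z) = \<Phi> (cis (t (j + q)))"
          by (subst z) (simp add: cis_mult)
      qed
      also have "\<dots> = (\<Prod>j<m. \<Phi> (cis (t j)))"
      proof (rule prod_shift_periodic)
        fix j
        have "t (j + m) = t j + 2 * pi"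
          using \<open>m > 0\<close> by (simp add: t_def field_simps)
        then show "\<Phi> (cis (t (j + m))) = \<Phi> (cis (t j))"
          by (simp flip: cis_mult)
      qed
      also have "\<dots> = \<Phi> (cis (t 0)) * (\<Prod>j\<in>{1..<m}. \<Phi> (cis (t j)))"
        using \<open>m > 0\<close> by (simp add: lessThan_atLeast0 prod.atLeast_Suc_lessThan)
      finally have "norm (F z) = norm (\<Phi> (cis (t 0))) * (\<Prod>j\<in>{1..<m}. norm (\<Phi> (cis (t j))))"
        by (simp add: norm_mult prod_norm)
      also have "\<dots> \<le> S * ((1 + \<eta>) ^ m * B ^ (2 * k))"
      proof (rule mult_mono)
        show "norm (\<Phi> (cis (t 0))) \<le> S"
          using near[of "t 0"] \<theta> by (simp add: t_def)
        then show "0 \<le> S" using norm_ge_zero order_trans by blast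
        \<comment> \<open>Since \<open>k * (2 * pi / m) \<ge> \<delta>\<close>, only the first and
          the last \<open>k\<close> angles can be closer than \<open>\<delta>\<close> to 0 or to
          \<open>2 * pi\<close>.\<close>
        define bad where "bad = {..<k} \<union> {m - k..<m}"
        have "norm (\<Phi> (cis (t j))) \<le> (if j \<in> bad then B else 1 + \<eta>)" if "j < m" for j
        proof (cases "j \<in> bad")
          case True
          then show ?thesis using bound by simp
        next
          case False
          then have j: "k \<le> j" "j + k < m" using that by (auto simp: bad_def)
          have "m * \<delta> / (2 * pi) < k" unfolding k_def by linarith
          then have \<delta>: "\<delta> \<le> 2 * pi * k / m"
            using \<open>m > 0\<close> by (simp add: field_simps)
          also have "\<dots> \<le> 2 * pi * j / m"
            using j by (intro divide_right_mono mult_left_mono) auto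
          also have "\<dots> \<le> t j" using \<theta> by (simp add: t_def)
          finally have lower: "\<delta> \<le> t j" .
          have "t j \<le> 2 * pi * (real j + 1) / m"
            using \<theta> by (simp add: t_def add_divide_distrib distrib_left)
          also have "\<dots> \<le> 2 * pi * (real m - k) / m"
            using j by (intro divide_right_mono mult_left_mono) auto
          also have "\<dots> = 2 * pi - 2 * pi * k / m"
            using \<open>m > 0\<close> by (simp add: field_simps)
          finally have upper: "t j \<le> 2 * pi - \<delta>" using \<delta> by linarith
          have "norm (\<Phi> (cis (t j))) \<le> 1 + \<eta>"
          proof (cases "t j \<le> pi")
            case True
            then show ?thesis using lower \<open>\<delta> \<ge> 0\<close> by (intro far) auto
          next
            case False
            have "norm (\<Phi> (cis (t j - 2 * pi))) \<le> 1 + \<eta>"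
              using False upper \<open>\<delta> \<ge> 0\<close> by (intro far) auto
            then show ?thesis by (simp flip: cis_divide)
          qed
          then show ?thesis using False by simp
        qed
        then have "(\<Prod>j\<in>{1..<m}. norm (\<Phi> (cis (t j))))
            \<le> (\<Prod>j\<in>{1..<m}. if j \<in> bad then B else 1 + \<eta>)"
          by (intro prod_mono) auto
        also have "\<dots> = (1 + \<eta>) ^ card ({1..<m} - bad) * B ^ card ({1..<m} \<inter> bad)"
          by (simp add: prod.If_cases Diff_eq mult.commute)
        also have "\<dots> \<le> (1 + \<eta>) ^ m * B ^ (2 * k)"
        proof (intro mult_mono power_increasing)
          have "card ({1..<m} - bad) \<le> card {1..<m}" by (rule card_mono) auto
          then show "card ({1..<m} - bad) \<le> m" by simp
          have "card ({1..<m} \<inter> bad) \<le> card bad"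
            by (rule card_mono) (auto simp: bad_def)
          also have "\<dots> \<le> card {..<k} + card {m - k..<m}"
            unfolding bad_def by (rule card_Un_le)
          also have "\<dots> \<le> 2 * k" by simp
          finally show "card ({1..<m} \<inter> bad) \<le> 2 * k" .
        qed (use \<open>B \<ge> 1\<close> \<open>\<eta> \<ge> 0\<close> in auto)
        finally show "(\<Prod>j\<in>{1..<m}. norm (\<Phi> (cis (t j)))) \<le> (1 + \<eta>) ^ m * B ^ (2 * k)" .
      qed (auto intro: prod_nonneg)
      finally show ?thesis by (simp add: mult.assoc)
    qed
  qed auto
  moreover have "F 0 = 1" using \<open>\<Phi> 0 = 1\<close> by (simp add: F_def)
  ultimately show ?thesis by (simp add: k_def)
qed

section \<open>A lacunary self-map of the disc\<close>

text \<open>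
  The weights are such that for every \<open>t \<noteq> 0\<close> some frequency \<open>2 ^ i \<approx> 1 / \<bar>t\<bar>\<close>, of weight about
  \<open>\<bar>t\<bar>\<close>, is out of phase with the leading term: the modulus on the unit circle drops below 1
  linearly in \<open>\<bar>t\<bar>\<close>, while the image stays within \<open>O(I * \<bar>t\<bar>)\<close> of 1. The missing mass
  \<open>(1/2) ^ (I + 1)\<close> keeps the image of the closed disc inside the open disc.
\<close>

definition lacunary :: "nat \<Rightarrow> complex \<Rightarrow> complex" where
  "lacunary I z = z * (1/2 + (\<Sum>i<I. (1/2) ^ (i + 2) * z ^ (2 ^ i)))"

lemma sum_half_powers: "(\<Sum>i<I. (1/2 :: 'a :: field_char_0) ^ (i + 2)) = 1/2 - (1/2) ^ (I + 1)"
proof (induction I)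
  case (Suc I)
  show ?case by (subst sum.lessThan_Suc, subst Suc) (simp add: field_simps)
qed simp

lemma lacunary_0 [simp]: "lacunary I 0 = 0"
  by (simp add: lacunary_def)

lemma holomorphic_on_lacunary: "lacunary I holomorphic_on S"
  unfolding lacunary_def [abs_def] by (intro holomorphic_intros)

lemma norm_lacunary_le:
  assumes "norm z \<le> 1"
  shows "norm (lacunary I z) \<le> 1 - (1/2) ^ (I + 1)"
proof -
  have "norm (lacunary I z) \<le> norm (1/2 + (\<Sum>i<I. (1/2) ^ (i + 2) * z ^ (2 ^ i)))"
    unfolding lacunary_def norm_mult using assms by (intro mult_left_le_one_le) auto
  also have "\<dots> \<le> 1/2 + (\<Sum>i<I. (1/2) ^ (i + 2))"
    using assms
    by (intro norm_triangle_mono sum_norm_le)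
      (auto simp: norm_mult norm_power norm_divide intro!: mult_left_le power_le_one)
  also have "\<dots> = 1 - (1/2) ^ (I + 1)" by (simp only: sum_half_powers)
  finally show ?thesis .
qed

text \<open>If \<open>w\<close> has nonpositive real part, \<open>1/2 + p * w\<close> has squared
  modulus at most \<open>1/4 + p * p\<close>, hence modulus at most \<open>1/2 + p/2\<close>.
  Compared with the triangle inequality this saves \<open>p/2\<close>, and all other terms are
  bounded trivially.\<close>

lemma norm_lacunary_le_of_Re_nonpos:
  assumes "norm z = 1" and "i < I" and Re: "Re (z ^ (2 ^ i)) \<le> 0"
  shows "norm (lacunary I z) \<le> 1 - (1/2) ^ (i + 3)"
proof -
  define w where "w = z ^ (2 ^ i)"
  define p :: real where "p = (1/2) ^ (i + 2)"
  have w: "norm w = 1" "Re w \<le> 0"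
    using assms by (auto simp: w_def norm_power)
  have p: "0 < p" "p \<le> 1/4"
    using power_le_one[of "1/2::real" i] by (auto simp: p_def)
  have "(norm (1/2 + of_real p * w))\<^sup>2 \<le> (1/2 + p/2)\<^sup>2"
  proof -
    have "(Re w)\<^sup>2 + (Im w)\<^sup>2 = 1" using w by (simp add: cmod_power2 [symmetric])
    moreover have "(norm (1/2 + of_real p * w))\<^sup>2
        = 1/4 + p * Re w + p\<^sup>2 * ((Re w)\<^sup>2 + (Im w)\<^sup>2)"
      unfolding cmod_power2 by (simp add: power2_eq_square algebra_simps)
    ultimately have "(norm (1/2 + of_real p * w))\<^sup>2 \<le> 1/4 + p * p"
      using w p mult_nonneg_nonpos[of p "Re w"] by (simp add: power2_eq_square)
    also have "\<dots> \<le> 1/4 + (p / 2 + p * p / 4)"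
      using p mult_left_mono[of p "1/4" p] zero_le_square[of p] by linarith
    also have "\<dots> = (1/2 + p/2)\<^sup>2"
      by (simp add: power2_sum power_divide power2_eq_square [of p])
    finally show ?thesis .
  qed
  then have main: "norm (1/2 + of_real p * w) \<le> 1/2 + p/2"
    by (rule power2_le_imp_le) (use p in simp)
  let ?J = "{..<I} - {i}"
  have "(\<Sum>j<I. (1/2) ^ (j + 2) * z ^ (2 ^ j))
      = of_real p * w + (\<Sum>j\<in>?J. (1/2) ^ (j + 2) * z ^ (2 ^ j))"
    using \<open>i < I\<close> by (subst sum.remove[of _ i]) (auto simp: p_def w_def)
  then have "norm (lacunary I z)
      = norm ((1/2 + of_real p * w) + (\<Sum>j\<in>?J. (1/2) ^ (j + 2) * z ^ (2 ^ j)))"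
    unfolding lacunary_def norm_mult using assms by (simp only: add.assoc mult_1_left)
  also have "\<dots> \<le> (1/2 + p/2) + (\<Sum>j\<in>?J. (1/2) ^ (j + 2))"
    using assms
    by (intro norm_triangle_mono[OF main] sum_norm_le) (auto simp: norm_mult norm_power norm_divide)
  also have "\<dots> = 1/2 + (\<Sum>j<I. (1/2) ^ (j + 2)) - p/2"
    using \<open>i < I\<close> by (subst sum.remove[of "{..<I}" i]) (auto simp: p_def)
  also have "\<dots> = 1 - (1/2) ^ (I + 1) - p/2" by (simp only: sum_half_powers)
  also have "p/2 = (1/2) ^ (i + 3)" by (simp add: p_def eval_nat_numeral)
  also have "1 - (1/2) ^ (I + 1) - (1/2) ^ (i + 3) \<le> 1 - (1/2 :: real) ^ (i + 3)" by simp
  finally show ?thesis .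
qed

text \<open>Double \<open>\<bar>t\<bar>\<close> as long as it does not exceed \<open>pi\<close>; the
  last value lies in the interval from \<open>pi / 2\<close> to \<open>pi\<close>.\<close>

lemma ex_doubling_cos_nonpos:
  fixes t :: real
  assumes "t \<noteq> 0" and "\<bar>t\<bar> \<le> pi"
  shows "\<exists>i. cos (2 ^ i * t) \<le> 0 \<and> 2 ^ i * \<bar>t\<bar> \<le> pi"
proof -
  obtain k where k: "pi / \<bar>t\<bar> < 2 ^ k"
    using real_arch_pow[of 2 "pi / \<bar>t\<bar>"] by auto
  define i where "i = (LEAST k. pi < 2 ^ Suc k * \<bar>t\<bar>)"
  have "pi < 2 ^ k * \<bar>t\<bar>"
    using k \<open>t \<noteq> 0\<close> by (simp add: field_simps)
  also have "\<dots> \<le> 2 ^ Suc k * \<bar>t\<bar>" by simp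
  finally have "pi < 2 ^ Suc k * \<bar>t\<bar>" .
  then have i: "pi < 2 ^ Suc i * \<bar>t\<bar>" unfolding i_def by (rule LeastI)
  have le: "2 ^ i * \<bar>t\<bar> \<le> pi"
  proof (cases i)
    case 0
    then show ?thesis using assms by simp
  next
    case (Suc j)
    then have "\<not> pi < 2 ^ Suc j * \<bar>t\<bar>"
      unfolding i_def by (intro not_less_Least) simp
    then show ?thesis using Suc by simp
  qed
  have "cos (2 ^ i * \<bar>t\<bar>) \<le> cos (pi / 2)"
    using i le by (intro cos_monotone_0_pi_le) auto
  moreover have "cos (2 ^ i * \<bar>t\<bar>) = cos (2 ^ i * t)"
    by (cases "t \<ge> 0") auto
  ultimately show ?thesis using le by auto
qed

text \<open>The hypothesis \<open>pi < 2 ^ I * \<bar>t\<bar>\<close> ensures that the out-of-phase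
  frequency found by doubling is among the \<open>I\<close> present ones. The bound
  \<open>2 ^ i * \<bar>t\<bar> \<le> pi\<close> turns the saving into a multiple of
  \<open>\<bar>t\<bar>\<close>.\<close>

lemma norm_lacunary_cis_le:
  assumes "pi < 2 ^ I * \<bar>t\<bar>" and "\<bar>t\<bar> \<le> pi"
  shows "norm (lacunary I (cis t)) \<le> 1 - \<bar>t\<bar> / (8 * pi)"
proof -
  have "t \<noteq> 0" using assms by auto
  then obtain i where i: "cos (2 ^ i * t) \<le> 0" "2 ^ i * \<bar>t\<bar> \<le> pi"
    using ex_doubling_cos_nonpos assms by blast
  have "2 ^ i * \<bar>t\<bar> < 2 ^ I * \<bar>t\<bar>" using i assms by linarith
  then have "(2::real) ^ i < 2 ^ I" using \<open>t \<noteq> 0\<close> by simp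
  then have "i < I" by simp
  have "norm (lacunary I (cis t)) \<le> 1 - (1/2) ^ (i + 3)"
  proof (rule norm_lacunary_le_of_Re_nonpos)
    show "Re (cis t ^ (2 ^ i)) \<le> 0" using i by (simp add: Complex.DeMoivre)
  qed (use \<open>i < I\<close> in auto)
  moreover have "\<bar>t\<bar> / (8 * pi) \<le> (1/2) ^ (i + 3)"
    using i by (simp add: power_add field_simps power_divide)
  ultimately show ?thesis by linarith
qed

lemma norm_one_minus_cis_power_le: "norm (1 - cis t ^ k) \<le> k * \<bar>t\<bar>"
proof -
  have "norm (1 - cis (k * t)) = dist (exp (\<i> * of_real (k * t))) 1"
    by (simp add: cis_conv_exp dist_norm norm_minus_commute)
  also have "\<dots> = 2 * \<bar>sin (k * t / 2)\<bar>" by (simp only: dist_norm dist_exp_i_1)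
  also have "\<dots> \<le> 2 * \<bar>k * t / 2\<bar>" using abs_sin_x_le_abs_x[of "k * t / 2"] by linarith
  finally show ?thesis by (simp add: Complex.DeMoivre abs_mult)
qed

text \<open>The weights and the missing mass add up to 1, so \<open>1 - lacunary I z\<close> is that
  mass plus a weighted sum of terms \<open>1 - z ^ k\<close>. Each of these is at most
  \<open>k * \<bar>t\<bar>\<close>, while the weights decay like \<open>1 / k\<close>; thus every
  frequency contributes \<open>O(\<bar>t\<bar>)\<close>.\<close>

lemma norm_one_minus_lacunary_cis_le:
  "norm (1 - lacunary I (cis t)) \<le> (1/2) ^ (I + 1) + \<bar>t\<bar> * (1 + I / 4)"
proof -
  let ?z = "cis t"
  have "1 - lacunary I ?z = (1/2) ^ (I + 1)
      + (1/2 * (1 - ?z ^ 1) + (\<Sum>i<I. (1/2) ^ (i + 2) * (1 - ?z ^ (2 ^ i + 1))))"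
  proof -
    have "(\<Sum>i<I. (1/2) ^ (i + 2) * (1 - ?z ^ (2 ^ i + 1)))
        = (\<Sum>i<I. (1/2) ^ (i + 2)) - ?z * (\<Sum>i<I. (1/2) ^ (i + 2) * ?z ^ (2 ^ i))"
      unfolding sum_distrib_left sum_subtractf [symmetric]
      by (intro sum.cong) (auto simp: algebra_simps)
    moreover define a where "a = (\<Sum>i<I. (1/2) ^ (i + 2) * ?z ^ (2 ^ i))"
    moreover define g :: complex where "g = (1/2) ^ (I + 1)"
    moreover have "1 - ?z * (1/2 + a) = g + (1/2 * (1 - ?z ^ 1) + ((1/2 - g) - ?z * a))"
      by (simp add: field_simps)
    ultimately show ?thesis by (simp only: lacunary_def sum_half_powers)
  qed
  also have "norm \<dots> \<le> (1/2) ^ (I + 1) + (1/2 * (real 1 * \<bar>t\<bar>)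
      + (\<Sum>i<I. (1/2) ^ (i + 2) * (real (2 ^ i + 1) * \<bar>t\<bar>)))"
  proof (intro norm_triangle_mono sum_norm_le)
    show "norm (1/2 * (1 - ?z ^ 1)) \<le> 1/2 * (real 1 * \<bar>t\<bar>)"
      unfolding norm_mult by (intro mult_mono norm_one_minus_cis_power_le) auto
    show "norm ((1/2) ^ (i + 2) * (1 - ?z ^ (2 ^ i + 1)))
        \<le> (1/2) ^ (i + 2) * (real (2 ^ i + 1) * \<bar>t\<bar>)" for i
      unfolding norm_mult
      by (intro mult_mono norm_one_minus_cis_power_le) (auto simp: norm_power norm_divide)
  qed (simp add: norm_power norm_divide)
  also have "(\<Sum>i<I. (1/2) ^ (i + 2) * (real (2 ^ i + 1) * \<bar>t\<bar>))
      = (I / 4 + (\<Sum>i<I. (1/2) ^ (i + 2))) * \<bar>t\<bar>"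
  proof -
    have "(1/2) ^ (i + 2) * (real (2 ^ i + 1) * \<bar>t\<bar>) = (1/4 + (1/2) ^ (i + 2)) * \<bar>t\<bar>" for i
      by (simp add: field_simps power_divide power_add)
    then show ?thesis
      by (simp only: sum_distrib_right [symmetric] sum.distrib) simp
  qed
  also have "(1/2) ^ (I + 1) + (1/2 * (real 1 * \<bar>t\<bar>) + \<dots>)
      \<le> (1/2) ^ (I + 1) + (1/2 * (real 1 * \<bar>t\<bar>) + (I / 4 + 1/2) * \<bar>t\<bar>)"
    unfolding sum_half_powers by (intro add_left_mono mult_right_mono) auto
  also have "\<dots> = (1/2) ^ (I + 1) + \<bar>t\<bar> * (1 + I / 4)"
    by (simp add: distrib_left distrib_right)
  finally show ?thesis .
qed

section \<open>Vanishing at 1\<close>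

text \<open>In the expansion at 1 the coefficients of order below \<open>K\<close> vanish, and the
  one of order \<open>k\<close> is at most \<open>(n + 1) * n ^ k / fact k\<close>. For
  \<open>k \<ge> K\<close> the factor \<open>3 ^ k * exp (- K)\<close> is at least 1; inserting it
  yields the decay in \<open>K\<close>, and the rest sums to an exponential.\<close>

lemma norm_sum_powers_le_of_vanishing:
  fixes c :: "nat \<Rightarrow> real" and w :: complex and K n :: nat
  assumes vanish: "\<And>k. k < K \<Longrightarrow> (\<Sum>j\<le>n. c j * real (j choose k)) = 0"
    and c: "\<And>j. \<bar>c j\<bar> \<le> 1"
  shows "norm (\<Sum>j\<le>n. of_real (c j) * w ^ j) \<le> (real n + 1) * exp (3 * real n * norm (w - 1) - real K)"
proof -
  let ?x = "norm (w - 1)"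
  have "w ^ j = (\<Sum>k\<le>n. of_nat (j choose k) * (w - 1) ^ k)" if "j \<le> n" for j
  proof -
    have "w ^ j = (\<Sum>k\<le>j. of_nat (j choose k) * (w - 1) ^ k)"
      using binomial_ring[of "w - 1" 1 j] by simp
    also have "\<dots> = (\<Sum>k\<le>n. of_nat (j choose k) * (w - 1) ^ k)"
      using that by (intro sum.mono_neutral_left) auto
    finally show ?thesis .
  qed
  then have "(\<Sum>j\<le>n. of_real (c j) * w ^ j)
      = (\<Sum>j\<le>n. \<Sum>k\<le>n. of_real (c j * real (j choose k)) * (w - 1) ^ k)"
    by (simp add: sum_distrib_left mult.assoc)
  also have "\<dots> = (\<Sum>k\<le>n. of_real (\<Sum>j\<le>n. c j * real (j choose k)) * (w - 1) ^ k)"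
    by (subst sum.swap) (simp only: of_real_sum sum_distrib_right)
  also have "norm \<dots> \<le> (\<Sum>k\<le>n. (real n + 1) * ((3 * real n * ?x) ^ k / fact k * exp (- real K)))"
  proof (rule sum_norm_le)
    fix k
    show "norm (of_real (\<Sum>j\<le>n. c j * real (j choose k)) * (w - 1) ^ k)
        \<le> (real n + 1) * ((3 * real n * ?x) ^ k / fact k * exp (- real K))"
    proof (cases "k < K")
      case True
      then show ?thesis by (simp add: vanish)
    next
      case False
      have "\<bar>\<Sum>j\<le>n. c j * real (j choose k)\<bar> \<le> (\<Sum>j\<le>n. real n ^ k / fact k)"
      proof (intro order_trans[OF sum_abs] sum_mono)
        fix j assume "j \<in> {..n}"
        then have "(j choose k) * fact k \<le> n ^ k"
          by (intro order_trans[OF binomial_fact_pow] power_mono) auto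
        then have "real (j choose k) * fact k \<le> real n ^ k"
          by (metis of_nat_fact of_nat_le_iff of_nat_mult of_nat_power)
        then have "real (j choose k) \<le> real n ^ k / fact k"
          by (simp add: le_divide_eq)
        moreover have "\<bar>c j\<bar> * real (j choose k) \<le> real (j choose k)"
          using c by (intro mult_left_le_one_le) auto
        ultimately show "\<bar>c j * real (j choose k)\<bar> \<le> real n ^ k / fact k"
          by (simp add: abs_mult)
      qed
      also have "\<dots> = (real n + 1) * (real n ^ k / fact k * 1)" by simp
      also have "\<dots> \<le> (real n + 1) * (real n ^ k / fact k * (3 ^ k * exp (- real K)))"
      proof (intro mult_left_mono)
        have "exp (real K) \<le> exp (real k)" using False by simp
        also have "\<dots> = exp 1 ^ k" by (simp flip: exp_of_nat_mult)
        also have "\<dots> \<le> 3 ^ k" by (intro power_mono exp_le) auto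
        finally show "1 \<le> 3 ^ k * exp (- real K)"
          by (simp add: exp_minus field_simps)
      qed auto
      finally have "norm (of_real (\<Sum>j\<le>n. c j * real (j choose k)) * (w - 1) ^ k)
          \<le> (real n + 1) * (real n ^ k / fact k * (3 ^ k * exp (- real K))) * ?x ^ k"
        unfolding norm_mult norm_power norm_of_real by (intro mult_right_mono) auto
      then show ?thesis by (simp only: power_mult_distrib times_divide_eq_left times_divide_eq_right mult_ac)
    qed
  qed
  also have "\<dots> = (real n + 1) * ((\<Sum>k\<le>n. (3 * real n * ?x) ^ k / fact k) * exp (- real K))"
    by (simp only: sum_distrib_left sum_distrib_right)
  also have "\<dots> \<le> (real n + 1) * (exp (3 * real n * ?x) * exp (- real K))"
  proof (intro mult_left_mono mult_right_mono)
    have sums: "(\<lambda>k. (3 * real n * ?x) ^ k / fact k) sums exp (3 * real n * ?x)"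
      using exp_converges[of "3 * real n * ?x"] by (simp add: field_class.field_divide_inverse mult.commute)
    show "(\<Sum>k\<le>n. (3 * real n * ?x) ^ k / fact k) \<le> exp (3 * real n * ?x)"
      unfolding sums_unique[OF sums] by (rule sum_le_suminf[OF sums_summable[OF sums]]) auto
  qed auto
  finally show ?thesis by (simp flip: exp_add)
qed

text \<open>A lower bound valid down to \<open>n = 2\<close>, used to absorb additive constants into
  multiples of the logarithm.\<close>

lemma half_le_ln:
  assumes "n \<ge> 2"
  shows "1/2 \<le> ln (real n)"
proof -
  have "exp (1/2 :: real) * exp (1/2) \<le> 2 * 2"
    using exp_le by (simp flip: exp_add)
  then have "exp (1/2 :: real) \<le> 2"
    using mult_strict_mono[of 2 "exp (1/2 :: real)" 2 "exp (1/2)"] by linarith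
  then have "exp (1/2) \<le> real n" using assms by linarith
  then show ?thesis using assms by (subst ln_ge_iff) auto
qed

text \<open>Meant for the divisor \<open>u\<close>: as
  \<open>\<bar>a\<bar> * norm w ^ d \<le> norm w\<close>, the lower bound does not depend on
  \<open>d\<close>.\<close>

lemma norm_one_plus_power_ge:
  fixes w :: complex and a :: real
  assumes "norm w \<le> 1" "d \<ge> 1" "\<bar>a\<bar> \<le> 1"
  shows "1 - norm w \<le> norm (1 + of_real a * w ^ d)"
proof -
  have "norm (of_real a * w ^ d) \<le> norm w ^ d"
    using assms by (simp add: norm_mult norm_power mult_left_le_one_le)
  also have "\<dots> \<le> norm w ^ 1"
    using assms by (intro power_decreasing) auto
  finally have "1 - norm w \<le> norm (1 :: complex) - norm (- (of_real a * w ^ d))" by simp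
  also have "\<dots> \<le> norm (1 - - (of_real a * w ^ d))" by (rule norm_triangle_ineq2)
  finally show ?thesis by simp
qed

text \<open>The coefficient at \<open>d\<close> may be anything in the interval from -1 to 1,
  including 0, so a polynomial with no exponent between 0 and \<open>N\<close> is covered as well.
  The bound results from taking logarithms in the inequality for products of rotations.\<close>

lemma vanishing_order_le:
  fixes c :: "nat \<Rightarrow> real" and n K d :: nat
  defines "N \<equiv> real n powr (1/3)"
  assumes n: "n \<ge> 2" and c0: "c 0 = 1" and c: "\<And>j. \<bar>c j\<bar> \<le> 1"
    and d: "1 \<le> d" "d \<le> n"
    and gap: "\<And>j. 0 < j \<Longrightarrow> real j < N \<Longrightarrow> j \<noteq> d \<Longrightarrow> c j = 0"
    and vanish: "\<And>k. k < K \<Longrightarrow> (\<Sum>j\<le>n. c j * real (j choose k)) = 0"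
  shows "real K \<le> 600 * N * (ln n)\<^sup>2"
proof -
  define L where "L = ln (real n)"
  have L: "1/2 \<le> L" unfolding L_def using n by (rule half_le_ln)
  have expL: "exp L = n" using n by (simp add: L_def)
  have N: "1 \<le> N" unfolding N_def using n by (intro ge_one_powr_ge_zero) auto
  have NNN: "N * N * N = n"
    unfolding N_def using n by (simp flip: powr_add)
  have NN: "1 \<le> N * N" using mult_mono[OF N N] N by simp
  have Nn: "N \<le> n" "N * N \<le> n"
    unfolding NNN [symmetric] using N NN by (simp_all add: mult_le_cancel_right1 mult_le_cancel_left1)

  have NL: "1/2 \<le> N * L" using mult_mono[of 1 N "1/2" L] N L by simp

  define f where "f = (\<lambda>w::complex. \<Sum>j\<le>n. of_real (c j) * w ^ j)"
  define u where "u = (\<lambda>w::complex. 1 + of_real (c d) * w ^ d)"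
  define R where "R = (\<lambda>w::complex. \<Sum>j\<in>{..n}-{0,d}. of_real (c j) * w ^ j)"
  have f_eq: "f w = u w + R w" for w
  proof -
    have "{..n} = insert 0 (insert d ({..n} - {0,d}))" using d by auto
    then have "f w = (\<Sum>j\<in>insert 0 (insert d ({..n} - {0,d})). of_real (c j) * w ^ j)"
      by (simp only: f_def)
    also have "\<dots> = u w + R w"
      using d c0 by (subst sum.insert) (auto simp: u_def R_def)
    finally show ?thesis .
  qed
  have norm_term: "norm (of_real (c j) * w ^ j) \<le> norm w ^ j" for j and w :: complex
    unfolding norm_mult norm_power norm_of_real using c by (intro mult_left_le_one_le) auto
  have norm_f: "norm (f w) \<le> real n + 1" if "norm w \<le> 1" for w
  proof -
    have "norm (f w) \<le> (\<Sum>j\<le>n. 1)"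
      unfolding f_def using that
      by (intro sum_norm_le order_trans[OF norm_term] power_le_one) auto
    then show ?thesis by simp
  qed
  \<comment> \<open>Every nonzero term of \<open>R\<close> has degree at least \<open>N\<close>, and
    \<open>1 - x \<le> exp (- x)\<close>.\<close>
  have norm_R: "norm (R w) \<le> n * exp (- (x * N))" if "norm w \<le> 1 - x" "x \<ge> 0" for w x
  proof -
    have "norm (R w) \<le> (\<Sum>j\<in>{..n}-{0,d}. exp (- (x * N)))"
      unfolding R_def
    proof (rule sum_norm_le)
      fix j assume j: "j \<in> {..n} - {0,d}"
      show "norm (of_real (c j) * w ^ j) \<le> exp (- (x * N))"
      proof (cases "c j = 0")
        case False
        then have "N \<le> j" using gap[of j] j by force
        have "norm w \<le> exp (- x)"
          using that exp_ge_add_one_self[of "- x"] by linarith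
        then have "norm w ^ j \<le> exp (- x) ^ j" by (intro power_mono) auto
        also have "\<dots> = exp (- (x * j))" by (simp flip: exp_of_nat_mult add: mult.commute)
        also have "\<dots> \<le> exp (- (x * N))" using \<open>N \<le> j\<close> \<open>x \<ge> 0\<close> by (simp add: mult_left_mono)
        finally have "norm w ^ j \<le> exp (- (x * N))" .
        with norm_term[of j w] show ?thesis by linarith
      qed simp
    qed
    also have "\<dots> = real (card ({..n} - {0,d})) * exp (- (x * N))" by simp
    also have "card ({..n} - {0,d}) \<le> card {1..n}" by (intro card_mono) auto
    finally show ?thesis by (simp add: mult_right_mono)
  qed

  \<comment> \<open>\<open>2 ^ I\<close> lies between \<open>n\<close> and \<open>2 * n\<close>.
    Then the missing mass \<open>g\<close> is of order \<open>1 / n\<close>, and the linear drop of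
    the modulus holds for all \<open>\<bar>t\<bar>\<close> above \<open>pi / n\<close>.\<close>
  obtain i where i: "2 ^ i < n" "n \<le> 2 ^ (i + 1)"
    using ex_power_ivl2[of 2 n] n by auto
  define I where "I = i + 1"
  have I: "n \<le> 2 ^ I" "2 ^ I \<le> 2 * n" using i by (simp_all add: I_def)
  have I': "real n \<le> 2 ^ I" "2 ^ I \<le> 2 * real n"
    using of_nat_mono[OF I(1), where 'a = real] of_nat_mono[OF I(2), where 'a = real] by simp_all
  define g :: real where "g = (1/2) ^ (I + 1)"
  have "g = 1 / (2 * 2 ^ I)" by (simp add: g_def power_divide)
  then have g: "1 / (4 * n) \<le> g" "g \<le> 1 / (2 * n)" "0 < g"
    using I' n by (auto intro: frac_le)
  let ?h = "lacunary I"
  have h1: "norm (?h z) \<le> 1" and hg: "1 / (4 * n) \<le> 1 - norm (?h z)" if "norm z \<le> 1" for z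
    using norm_lacunary_le[OF that, of I] g unfolding g_def by linarith+
  have u_ge: "1 - norm (?h z) \<le> norm (u (?h z))" if "norm z \<le> 1" for z
    unfolding u_def using h1[OF that] d c by (intro norm_one_plus_power_ge) auto
  have u_pos: "0 < norm (u (?h z))" and u_inv: "1 / norm (u (?h z)) \<le> 4 * n" if "norm z \<le> 1" for z
  proof -
    have *: "1 / (4 * n) \<le> norm (u (?h z))" by (rule order_trans[OF hg[OF that] u_ge[OF that]])
    then show "0 < norm (u (?h z))" using n by (intro less_le_trans[OF _ *]) simp
    then show "1 / norm (u (?h z)) \<le> 4 * n" using * n by (simp add: field_simps)
  qed

  \<comment> \<open>Dividing by \<open>u\<close>, which has all terms of \<open>f\<close> of degree below \<open>N\<close>, makes the modulus at most \<open>1 + 1/n\<close>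
    away from 1; without it the product over the rotations would be of size \<open>exp (O(m))\<close>.\<close>
  define \<Phi> where "\<Phi> = (\<lambda>z. f (?h z) / u (?h z))"
  have hol: "\<Phi> holomorphic_on cball 0 1"
    unfolding \<Phi>_def
  proof (intro holomorphic_on_divide)
    have comp: "(\<lambda>z. F (?h z)) holomorphic_on cball 0 1" if "F holomorphic_on UNIV" for F
      using holomorphic_on_compose_gen[OF holomorphic_on_lacunary that] by (simp add: o_def)
    show "(\<lambda>z. f (?h z)) holomorphic_on cball 0 1"
      by (rule comp) (unfold f_def, intro holomorphic_intros)
    show "(\<lambda>z. u (?h z)) holomorphic_on cball 0 1"
      by (rule comp) (unfold u_def, intro holomorphic_intros)
    show "u (?h z) \<noteq> 0" if "z \<in> cball 0 1" for z
      using u_pos[of z] that by auto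
  qed
  have "R 0 = 0" "u 0 = 1" using d by (auto simp: R_def u_def intro!: sum.neutral)
  then have \<Phi>0: "\<Phi> 0 = 1" by (simp add: \<Phi>_def f_eq)

  \<comment> \<open>The trivial bound \<open>n + 1\<close> for \<open>f\<close> times the bound
    \<open>4 * n\<close> for \<open>1 / u\<close> is at most \<open>n ^ 5\<close>, which serves as
    \<open>B\<close>.\<close>
  have poly_le: "(real n + 1) * (4 * n) \<le> exp (5 * L)"
  proof -
    have "exp (5 * L) = real n ^ 5"
      by (simp add: expL exp_of_nat_mult[of 5, simplified])
    moreover have "(n + 1) * (4 * n) \<le> n ^ 5"
    proof -
      have "n + 1 \<le> 2 * n" using n by simp
      also have "\<dots> \<le> n * n" using n by simp
      finally have "(n + 1) * (4 * n) \<le> (n * n) * ((n * n) * n)"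
        using n mult_mono[of 2 n 2 n] by (intro mult_mono) auto
      then show ?thesis by (simp add: eval_nat_numeral mult.assoc)
    qed
    then have "real ((n + 1) * (4 * n)) \<le> real (n ^ 5)" by (rule of_nat_mono)
    ultimately show ?thesis by (simp add: distrib_right add.commute)
  qed
  have bound: "norm (\<Phi> (cis t)) \<le> exp (5 * L)" for t
  proof -
    have "norm (\<Phi> (cis t)) = norm (f (?h (cis t))) * (1 / norm (u (?h (cis t))))"
      by (simp add: \<Phi>_def norm_divide)
    also have "\<dots> \<le> (real n + 1) * (4 * n)"
      using u_inv[of "cis t"] norm_f[OF h1, of "cis t"] by (intro mult_mono) auto
    finally show ?thesis using poly_le by linarith
  qed

  \<comment> \<open>Chosen so that \<open>norm (?h (cis t)) \<le> 1 - x\<close> with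
    \<open>x * N = 4 * L\<close> whenever \<open>\<delta> \<le> \<bar>t\<bar> \<le> pi\<close>. Each
    term of \<open>R\<close> is then at most \<open>1 / n ^ 4\<close>; with at most \<open>n\<close>
    terms and \<open>1 / norm u \<le> n\<close> the quotient is at most
    \<open>1 / n ^ 2\<close>.\<close>
  define \<delta> where "\<delta> = 32 * pi * L / N"
  have far: "norm (\<Phi> (cis t)) \<le> 1 + 1 / n" if "\<delta> \<le> \<bar>t\<bar>" "\<bar>t\<bar> \<le> pi" for t
  proof -
    define x where "x = 4 * L / N"
    have x: "1 / n \<le> x" "0 < x" "x * N = 4 * L"
    proof -
      have "1 * 1 \<le> (4 * L) * (n / N)" using L N Nn by (intro mult_mono) auto
      then show "1 / n \<le> x" using N n by (simp add: x_def field_simps)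
    qed (use L N in \<open>auto simp: x_def\<close>)
    have "pi < n * \<delta>"
    proof -
      have "pi * 1 < (32 * pi * L) * (n / N)"
        using L N Nn by (intro mult_less_le_imp_less) (auto simp: field_simps)
      then show ?thesis by (simp add: \<delta>_def mult_ac)
    qed
    also have "\<dots> \<le> 2 ^ I * \<bar>t\<bar>"
      using I' that L N by (intro mult_mono) (auto simp: \<delta>_def)
    finally have "norm (?h (cis t)) \<le> 1 - \<bar>t\<bar> / (8 * pi)"
      using that by (intro norm_lacunary_cis_le)
    also have "\<dots> \<le> 1 - \<delta> / (8 * pi)"
      using that by (intro diff_left_mono divide_right_mono) auto
    also have "\<delta> / (8 * pi) = x" by (simp add: \<delta>_def x_def)
    finally have h: "norm (?h (cis t)) \<le> 1 - x" .
    have "u (?h (cis t)) \<noteq> 0" using u_pos[of "cis t"] by auto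
    then have "\<Phi> (cis t) = 1 + R (?h (cis t)) / u (?h (cis t))"
      by (simp add: \<Phi>_def f_eq add_divide_distrib)
    then have "norm (\<Phi> (cis t)) \<le> 1 + norm (R (?h (cis t))) / norm (u (?h (cis t)))"
      using norm_triangle_ineq[of 1 "R (?h (cis t)) / u (?h (cis t))"] by (simp add: norm_divide)
    also have "\<dots> \<le> 1 + n * exp (- (x * N)) / (1 / n)"
      using norm_R[OF h] h u_ge[of "cis t"] x n by (intro add_left_mono frac_le) auto
    also have "n * exp (- (x * N)) / (1 / n) = 1 / (real n * real n)"
    proof -
      have "exp (4 * L) = real n ^ 4" by (simp add: expL exp_of_nat_mult[of 4, simplified])
      then show ?thesis unfolding x(3) using n by (simp add: exp_minus eval_nat_numeral field_simps)
    qed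
    also have "\<dots> \<le> 1 / n" using n by (simp add: field_simps)
    finally show ?thesis by simp
  qed

  \<comment> \<open>Two demands meet at \<open>m\<close> of order \<open>N * N\<close>: for
    \<open>\<bar>t\<bar> \<le> 2 * pi / m\<close> the exponent
    \<open>n * norm (?h (cis t) - 1)\<close> is \<open>O(N * L)\<close>, and
    \<open>(1 + 1 / n) ^ m\<close> stays bounded because \<open>m \<le> 2 * n\<close>.\<close>
  define m where "m = nat \<lceil>N * N\<rceil>"
  have m: "N * N \<le> m" "m \<le> 2 * (N * N)" "m > 0"
    using NN unfolding m_def by linarith+
  \<comment> \<open>\<open>5 * L\<close> comes from the polynomial factors. The exponent is at most
    \<open>3 * (1/2 + 8 * pi * (N * L))\<close>, and 100 suffices because \<open>pi < 4\<close> and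
    \<open>N * L \<ge> 1/2\<close>.\<close>
  define S where "S = exp (5 * L + 100 * (N * L) - K)"
  have near: "norm (\<Phi> (cis t)) \<le> S" if "\<bar>t\<bar> \<le> 2 * pi / m" for t
  proof -
    have "real I * (1/2) \<le> real I * ln 2"
      using half_le_ln[of 2] by (intro mult_left_mono) auto
    also have "\<dots> = ln (2 ^ I)" by (simp add: ln_realpow)
    also have "\<dots> \<le> ln (2 * real n)" using I' n by simp
    also have "\<dots> \<le> 1 + L" using n ln_2_less_1 by (simp add: ln_mult L_def)
    finally have "1 + real I / 4 \<le> 4 * L" using L by linarith
    have "norm (1 - ?h (cis t)) \<le> g + \<bar>t\<bar> * (1 + I / 4)"
      using norm_one_minus_lacunary_cis_le[of I t] by (simp add: g_def)
    also have "\<dots> \<le> 1 / (2 * n) + (2 * pi / m) * (4 * L)"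
      using that g \<open>1 + real I / 4 \<le> 4 * L\<close> by (intro add_mono mult_mono) auto
    also have "\<dots> \<le> 1 / (2 * n) + (2 * pi / (N * N)) * (4 * L)"
      using m L NN by (intro add_left_mono mult_right_mono frac_le) auto
    finally have "n * norm (1 - ?h (cis t)) \<le> n * (1 / (2 * n) + (2 * pi / (N * N)) * (4 * L))"
      by (intro mult_left_mono) auto
    also have "\<dots> = 1/2 + 8 * pi * (N * L)"
      using n N by (simp add: NNN [symmetric] field_simps)
    finally have y: "n * norm (?h (cis t) - 1) \<le> 1/2 + 8 * pi * (N * L)"
      by (simp add: norm_minus_commute)
    have "pi * (N * L) \<le> 4 * (N * L)"
      using NL pi_less_4 by (intro mult_right_mono) auto
    with y NL have exponent: "3 * real n * norm (?h (cis t) - 1) \<le> 100 * (N * L)"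
      by linarith
    have "norm (f (?h (cis t))) \<le> (real n + 1) * exp (3 * real n * norm (?h (cis t) - 1) - K)"
      unfolding f_def using vanish c by (rule norm_sum_powers_le_of_vanishing)
    also have "\<dots> \<le> (real n + 1) * exp (100 * (N * L) - K)"
      using exponent by (intro mult_left_mono) auto
    finally have "norm (f (?h (cis t))) * (1 / norm (u (?h (cis t))))
        \<le> ((real n + 1) * exp (100 * (N * L) - K)) * (4 * n)"
      using u_inv[of "cis t"] by (intro mult_mono) auto
    also have "\<dots> = (real n + 1) * (4 * n) * exp (100 * (N * L) - K)" by (simp only: mult_ac)
    also have "\<dots> \<le> exp (5 * L) * exp (100 * (N * L) - K)"
      using poly_le by (intro mult_right_mono) auto
    also have "\<dots> = S" by (simp add: S_def flip: exp_add)
    finally show ?thesis by (simp add: \<Phi>_def norm_divide)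
  qed

  \<comment> \<open>Bounds the number of factors for which only \<open>n ^ 5\<close> is available;
    it is \<open>O(m * \<delta>) = O(N * L)\<close>, and each costs \<open>5 * L\<close> in the
    exponent.\<close>
  define q where "q = 2 * nat \<lfloor>m * \<delta> / (2 * pi)\<rfloor> + 2"
  have "1 \<le> S * (1 + 1 / n) ^ m * exp (5 * L) ^ q"
    unfolding q_def
  proof (rule one_le_prod_rotations_bound[of \<Phi>])
    show "\<Phi> holomorphic_on ball 0 1" using hol by (rule holomorphic_on_subset) auto
    show "continuous_on (cball 0 1) \<Phi>" using hol by (rule holomorphic_on_imp_continuous_on)
  qed (use \<Phi>0 m L N bound far near in \<open>auto simp: \<delta>_def\<close>)
  also have "\<dots> \<le> S * exp 2 * exp (5 * L) ^ q"
  proof (intro mult_right_mono mult_left_mono)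
    have "(1 + 1 / n) ^ m \<le> exp (1 / n) ^ m"
      by (intro power_mono exp_ge_add_one_self) auto
    also have "\<dots> = exp (m / n)" by (simp flip: exp_of_nat_mult)
    also have "m / n \<le> 2" using m Nn n by (simp add: divide_le_eq)
    finally show "(1 + 1 / n) ^ m \<le> exp 2" by simp
  qed (auto simp: S_def)
  also have "\<dots> = exp (5 * L + 100 * (N * L) - K + 2 + q * (5 * L))"
    by (simp add: S_def flip: exp_add exp_of_nat_mult)
  finally have K: "real K \<le> 5 * L + 100 * (N * L) + 2 + q * (5 * L)"
    by (simp add: one_le_exp_iff)
  have "q \<le> 64 * (N * L) + 2"
  proof -
    have "real (nat \<lfloor>m * \<delta> / (2 * pi)\<rfloor>) \<le> m * \<delta> / (2 * pi)"
      using L N by (intro of_nat_floor) (auto simp: \<delta>_def)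
    also have "\<dots> = 16 * (m * (L / N))" by (simp add: \<delta>_def)
    also have "\<dots> \<le> 16 * (2 * (N * N) * (L / N))"
      using m L N by (intro mult_left_mono mult_right_mono) auto
    also have "\<dots> = 32 * (N * L)" using N by simp
    finally show ?thesis by (simp add: q_def mult.commute[of N L])
  qed
  then have "q * (5 * L) \<le> (64 * (N * L) + 2) * (5 * L)"
    using L by (intro mult_right_mono) auto
  also have "\<dots> = 320 * (N * L\<^sup>2) + 10 * L" by (simp add: power2_eq_square distrib_right)
  finally have "q * (5 * L) \<le> 320 * (N * L\<^sup>2) + 10 * L" .
  moreover have NL2: "N * L \<le> 2 * (N * L\<^sup>2)"
    using mult_left_mono[of 1 "2 * L" "N * L"] L NL by (simp add: power2_eq_square mult_ac)
  moreover have "L \<le> N * L" using N L by (simp add: mult_le_cancel_right1)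
  ultimately show ?thesis using K NL unfolding L_def [symmetric] by linarith
qed

section \<open>Residue counts\<close>

text \<open>Modulo \<open>p\<close> the function \<open>G\<close> is constant on each residue class,
  so its sum over a finite set depends only on the class sizes.\<close>

lemma sum_cong_of_card_residue_part_eq:
  fixes G :: "nat \<Rightarrow> int"
  assumes "finite A" "finite B" "p > 0"
    and card_eq: "\<And>i. i < p \<Longrightarrow> card (residue_part A i p) = card (residue_part B i p)"
    and G: "\<And>a b. [a = b] (mod p) \<Longrightarrow> [G a = G b] (mod int p)"
  shows "[sum G A = sum G B] (mod int p)"
proof -
  have *: "[sum G X = (\<Sum>i<p. int (card (residue_part X i p)) * G i)] (mod int p)" if "finite X" for X
  proof -
    have "sum G X = (\<Sum>i<p. \<Sum>a\<in>{a \<in> X. a mod p = i}. G a)"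
      using that \<open>p > 0\<close> by (intro sum.group [symmetric]) auto
    also have "\<dots> = (\<Sum>i<p. \<Sum>a\<in>residue_part X i p. G a)"
      by (intro sum.cong) (auto simp: residue_part_def Cong.cong_def)
    also have "[\<dots> = (\<Sum>i<p. \<Sum>a\<in>residue_part X i p. G i)] (mod int p)"
      by (intro cong_sum G) (auto simp: residue_part_def)
    finally show ?thesis by simp
  qed
  have "(\<Sum>i<p. int (card (residue_part A i p)) * G i) = (\<Sum>i<p. int (card (residue_part B i p)) * G i)"
    using card_eq by (intro sum.cong) auto
  with *[OF \<open>finite A\<close>] *[OF \<open>finite B\<close>] show ?thesis
    by (metis cong_sym cong_trans)
qed

lemma prod_diff_eq_binomial_fact:
  "(\<Prod>i<k. int j - int i) = int ((j choose k) * fact k)"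
proof -
  have "real_of_int (\<Prod>i<k. int j - int i) = (\<Prod>i=0..<k. real j - real i)"
    by (simp add: lessThan_atLeast0)
  also have "\<dots> = real_of_int (int ((j choose k) * fact k))"
    by (simp add: gbinomial_mult_fact' [symmetric] binomial_gbinomial)
  finally show ?thesis by (simp only: of_int_eq_iff)
qed

text \<open>Separation enters only near \<open>r\<close>: among the integers strictly between
  \<open>r\<close> and \<open>r + N\<close> there is no element of \<open>A\<close> and at most one
  of \<open>B\<close>, which gives the single exceptional exponent \<open>d\<close>. The size of
  \<open>\<Prod>P\<close> forces the moments of order below \<open>K\<close> to vanish.\<close>

lemma separated_differing_residues:
  fixes n K r :: nat and A B P :: "nat set"
  defines "N \<equiv> real n powr (1/3)"
  assumes n: "n \<ge> 2" and A: "A \<subseteq> {1..n}" and B: "B \<subseteq> {1..n}"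
    and sepA: "separated N A" and sepB: "separated N B"
    and r: "r \<in> A" "r \<notin> B" and below: "\<And>a. a < r \<Longrightarrow> a \<in> A \<longleftrightarrow> a \<in> B"
    and K: "600 * N * (ln n)\<^sup>2 < real K"
    and P: "finite P" "\<And>p. p \<in> P \<Longrightarrow> prime p" "n ^ (K + 1) < \<Prod>P"
  shows "\<exists>p\<in>P. \<exists>i<p. card (residue_part A i p) \<noteq> card (residue_part B i p)"
proof (rule ccontr)
  assume "\<not> ?thesis"
  then have card_eq: "card (residue_part A i p) = card (residue_part B i p)" if "p \<in> P" "i < p" for p i
    using that by blast
  have fin: "finite A" "finite B" using A B by (auto intro: finite_subset)
  have "r \<le> n" using r A by auto
  define c :: "nat \<Rightarrow> int" where "c = (\<lambda>j. of_bool (j + r \<in> A) - of_bool (j + r \<in> B))"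
  have c_le: "\<bar>c j\<bar> \<le> 1" for j by (simp add: c_def)
  have vanish: "(\<Sum>j\<le>n. c j * (\<Prod>i<k. int j - int i)) = 0" if "k < K" for k
  proof (rule ccontr)
    \<comment> \<open>Falling factorials of \<open>a - r\<close> rather than powers of \<open>a\<close>: they give the Taylor coefficients
      of \<open>f\<close> at 1 directly, up to the factor \<open>fact k\<close>.\<close>
    define G where "G = (\<lambda>a::nat. \<Prod>i<k. int a - int r - int i)"
    define T where "T = (\<Sum>j\<le>n. c j * (\<Prod>i<k. int j - int i))"
    assume "\<not> ?thesis"
    then have "T \<noteq> 0" by (simp add: T_def)
    let ?b = "\<lambda>a. (of_bool (a \<in> A) - of_bool (a \<in> B)) * G a"
    have restrict: "(\<Sum>a\<le>n + r. of_bool (a \<in> X) * G a) = sum G X" if "X \<subseteq> {1..n}" for X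
    proof -
      have "(\<Sum>a\<le>n + r. of_bool (a \<in> X) * G a) = (\<Sum>a\<in>X. of_bool (a \<in> X) * G a)"
        using that by (intro sum.mono_neutral_right) auto
      then show ?thesis by simp
    qed
    have "T = (\<Sum>j=0..n. ?b (j + r))"
      by (simp add: T_def c_def G_def atLeast0AtMost)
    also have "\<dots> = (\<Sum>a=0 + r..n + r. ?b a)"
      by (rule sum.shift_bounds_cl_nat_ivl [symmetric])
    \<comment> \<open>The terms with \<open>a < r\<close> are zero because \<open>A\<close> and
      \<open>B\<close> agree below \<open>r\<close>.\<close>
    also have "\<dots> = (\<Sum>a\<le>n + r. ?b a)"
      using below by (intro sum.mono_neutral_left) (auto simp: not_le)
    also have "\<dots> = sum G A - sum G B"
      by (simp only: left_diff_distrib sum_subtractf restrict[OF A] restrict[OF B])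
    finally have T: "T = sum G A - sum G B" .
    have "p dvd nat \<bar>T\<bar>" if "p \<in> P" for p
    proof -
      have "[sum G A = sum G B] (mod int p)"
        using fin P(2)[OF that] card_eq[OF that]
      proof (intro sum_cong_of_card_residue_part_eq)
        show "[G a = G b] (mod int p)" if "[a = b] (mod p)" for a b
          unfolding G_def using that by (intro cong_prod cong_diff cong_refl) (simp add: cong_int_iff)
      qed (auto simp: prime_gt_0_nat)
      then have "int p dvd T" by (simp add: T cong_iff_dvd_diff)
      then have "int p dvd int (nat \<bar>T\<bar>)" by simp
      then show ?thesis by (simp only: int_dvd_int_iff)
    qed
    then have "\<Prod>P dvd nat \<bar>T\<bar>" using P by (intro prod_primes_dvd) auto
    then have "\<Prod>P \<le> nat \<bar>T\<bar>" using \<open>T \<noteq> 0\<close> by (intro dvd_imp_le) auto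
    also have "nat \<bar>T\<bar> \<le> (n + 1) * n ^ k"
    proof -
      have "\<bar>T\<bar> \<le> (\<Sum>j\<le>n. int (n ^ k))"
        unfolding T_def
      proof (intro order_trans[OF sum_abs] sum_mono)
        fix j assume j: "j \<in> {..n}"
        have "\<bar>c j * (\<Prod>i<k. int j - int i)\<bar> \<le> int ((j choose k) * fact k)"
          unfolding abs_mult prod_diff_eq_binomial_fact abs_of_nat
          using c_le by (intro mult_left_le_one_le) auto
        also have "(j choose k) * fact k \<le> n ^ k"
          using j by (intro order_trans[OF binomial_fact_pow] power_mono) auto
        finally show "\<bar>c j * (\<Prod>i<k. int j - int i)\<bar> \<le> int (n ^ k)" by simp
      qed
      also have "\<dots> = int ((n + 1) * n ^ k)" by (simp add: distrib_right)
      finally show ?thesis by linarith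
    qed
    also have "\<dots> \<le> n ^ 2 * n ^ k"
    proof (rule mult_right_mono)
      have "n + 1 \<le> n * 2" using n by simp
      also have "\<dots> \<le> n * n" using n by (intro mult_left_mono) auto
      finally show "n + 1 \<le> n ^ 2" by (simp add: power2_eq_square)
    qed simp
    also have "\<dots> \<le> n ^ (K + 1)"
      unfolding power_add [symmetric] using n \<open>k < K\<close> by (intro power_increasing) auto
    finally show False using P(3) by linarith
  qed
  \<comment> \<open>Since \<open>r\<close> itself is in \<open>A\<close>, separation of
    \<open>A\<close> leaves only \<open>B\<close> as the source of a nonzero coefficient in the
    gap.\<close>
  have c_cases: "j + r \<in> B \<and> c j = -1" if "0 < j" "real j < N" "c j \<noteq> 0" for j
  proof -
    have "j + r \<notin> A"
    proof
      assume "j + r \<in> A"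
      then have "\<bar>real (j + r) - real r\<bar> \<ge> N"
        using sepA r that unfolding separated_def by fastforce
      then show False using that by simp
    qed
    then show ?thesis using that by (auto simp: c_def split: if_splits)
  qed
  have unique: "j = j'" if "0 < j" "real j < N" "c j \<noteq> 0" "0 < j'" "real j' < N" "c j' \<noteq> 0" for j j'
  proof (rule ccontr)
    assume "j \<noteq> j'"
    then have "\<bar>real (j + r) - real (j' + r)\<bar> \<ge> N"
      using sepB c_cases[OF that(1-3)] c_cases[OF that(4-6)] unfolding separated_def by fastforce
    then show False using that by linarith
  qed
  obtain d where d: "1 \<le> d" "d \<le> n" "\<And>j. 0 < j \<Longrightarrow> real j < N \<Longrightarrow> j \<noteq> d \<Longrightarrow> c j = 0"
  proof (cases "\<exists>j. 0 < j \<and> real j < N \<and> c j \<noteq> 0")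
    case True
    then obtain d where d: "0 < d" "real d < N" "c d \<noteq> 0" by blast
    show thesis
    proof (rule that[of d])
      show "1 \<le> d" using d by simp
      show "d \<le> n" using c_cases[OF d] B by auto
      show "c j = 0" if "0 < j" "real j < N" "j \<noteq> d" for j
        using unique[OF that(1,2) _ d] that(3) by blast
    qed
  next
    case False
    \<comment> \<open>With all coefficients in the gap equal to 0, any admissible \<open>d\<close>
      will do.\<close>
    then show thesis using n by (intro that[of 1]) auto
  qed
  have "real K \<le> 600 * N * (ln n)\<^sup>2"
    unfolding N_def
  proof (rule vanishing_order_le[OF n _ _ d(1,2), of "\<lambda>j. real_of_int (c j)"])
    show "real_of_int (c 0) = 1" using r by (simp add: c_def)
    show "\<bar>real_of_int (c j)\<bar> \<le> 1" for j
      using c_le[of j] by linarith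
    show "real_of_int (c j) = 0" if "0 < j" "real j < real n powr (1/3)" "j \<noteq> d" for j
      using d(3) that by (simp add: N_def)
    show "(\<Sum>j\<le>n. real_of_int (c j) * real (j choose k)) = 0" if "k < K" for k
    proof -
      have "0 = real_of_int (\<Sum>j\<le>n. c j * (\<Prod>i<k. int j - int i))"
        by (simp only: vanish[OF that] of_int_0)
      also have "\<dots> = (\<Sum>j\<le>n. real_of_int (c j) * real (j choose k)) * fact k"
        unfolding prod_diff_eq_binomial_fact by (simp add: sum_distrib_right mult.assoc)
      finally show ?thesis by simp
    qed
  qed
  with K show False by linarith
qed

section \<open>Choice of the constant and conclusion\<close>

theorem theorem2:
  shows "\<exists>C'::real. C' > 0 \<and>
    (\<forall>n::nat. n \<ge> 2 \<longrightarrow>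
      (\<forall>A B :: nat set.
        A \<subseteq> {1..n} \<longrightarrow> B \<subseteq> {1..n} \<longrightarrow> A \<noteq> B \<longrightarrow>
        separated (real n powr (1/3)) A \<longrightarrow> separated (real n powr (1/3)) B \<longrightarrow>
        (\<exists>p::nat. prime p \<and>
          real p \<in> {1/2 * C' * real n powr (1/3) * (ln (real n)) ^ 6 ..
                     C' * real n powr (1/3) * (ln (real n)) ^ 6} \<and>
          (\<exists>i\<in>{0..p - 1}. card (residue_part A i p) \<noteq> card (residue_part B i p)))))"
proof -
  obtain x0 :: real where x0: "x0 \<ge> 1"
    "\<And>x. x \<ge> x0 \<Longrightarrow> exp (x / 10) < real (\<Prod>{p. prime p \<and> x / 2 \<le> real p \<and> real p \<le> x})"
    using prod_primes_half_interval_ge by blast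
  \<comment> \<open>As \<open>L ^ 6 \<ge> 1/64\<close>, the summand \<open>64 * x0\<close> gives
    \<open>x \<ge> x0\<close> for every \<open>n \<ge> 2\<close>. The summand 50000 covers
    \<open>(K + 1) * L \<le> 4864 * (N * L ^ 6)\<close> with the factor 10 from
    \<open>exp (x / 10)\<close>.\<close>
  define C' where "C' = 50000 + 64 * x0"
  have "\<exists>p::nat. prime p \<and>
          real p \<in> {1/2 * C' * real n powr (1/3) * (ln (real n)) ^ 6 ..
                     C' * real n powr (1/3) * (ln (real n)) ^ 6} \<and>
          (\<exists>i\<in>{0..p - 1}. card (residue_part A i p) \<noteq> card (residue_part B i p))"
    if n: "n \<ge> 2" and A: "A \<subseteq> {1..n}" and B: "B \<subseteq> {1..n}" and "A \<noteq> B"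
      and sep: "separated (real n powr (1/3)) A" "separated (real n powr (1/3)) B"
    for n :: nat and A B :: "nat set"
  proof -
    define N where "N = real n powr (1/3)"
    define L where "L = ln (real n)"
    define x where "x = C' * N * L ^ 6"
    define P where "P = {p::nat. prime p \<and> x / 2 \<le> real p \<and> real p \<le> x}"
    define K where "K = nat \<lfloor>600 * N * L\<^sup>2\<rfloor> + 1"
    have L: "1/2 \<le> L" unfolding L_def using n by (rule half_le_ln)
    have N: "1 \<le> N" unfolding N_def using n by (intro ge_one_powr_ge_zero) auto
    have L_pow: "1 / 2 ^ k \<le> L ^ k" for k
      using power_mono[OF L, of k] by (simp add: power_divide)
    have "1 * (1/64) \<le> N * L ^ 6"
      using N L L_pow[of 6] by (intro mult_mono) auto
    then have "x0 * 1 \<le> x0 * (64 * (N * L ^ 6))"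
      using x0(1) by (intro mult_left_mono) auto
    moreover have "0 \<le> N * L ^ 6" using N L by simp
    moreover have "x = 50000 * (N * L ^ 6) + x0 * (64 * (N * L ^ 6))"
      by (simp add: x_def C'_def distrib_right mult.assoc)
    ultimately have x: "x0 \<le> x" "50000 * (N * L ^ 6) \<le> x"
      using x0(1) by linarith+
    have "real n ^ (K + 1) = exp ((K + 1) * L)"
      using n by (simp add: L_def exp_of_nat_mult del: of_nat_add of_nat_Suc)
    also have "(K + 1) * L \<le> x / 10"
    proof -
      have NL2: "1 / 4 \<le> N * L\<^sup>2"
        using mult_mono[OF N L_pow[of 2]] N by (simp add: power_divide)
      have "real K + 1 \<le> 600 * N * L\<^sup>2 + 2"
        using N by (simp add: K_def of_nat_floor)
      also have "\<dots> \<le> 608 * (N * L\<^sup>2)" using NL2 by simp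
      finally have "(K + 1) * L \<le> 608 * (N * L\<^sup>2) * L"
        using L by (intro mult_right_mono) auto
      also have "\<dots> = 608 * (N * L ^ 3) * 1" by (simp add: eval_nat_numeral)
      \<comment> \<open>From \<open>L \<ge> 1/2\<close>, the inequality
        \<open>1 \<le> 8 * L ^ 3\<close> passes to the sixth power occurring in
        \<open>x\<close>.\<close>
      also have "\<dots> \<le> 608 * (N * L ^ 3) * (8 * L ^ 3)"
        using N L L_pow[of 3] by (intro mult_left_mono) auto
      also have "\<dots> = 4864 * (N * L ^ 6)" by (simp add: eval_nat_numeral)
      finally show ?thesis using x \<open>0 \<le> N * L ^ 6\<close> by linarith
    qed
    then have "exp ((K + 1) * L) \<le> exp (x / 10)" by simp
    also have "exp (x / 10) < real (\<Prod>P)" unfolding P_def by (rule x0(2)[OF x(1)])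
    finally have big: "n ^ (K + 1) < \<Prod>P"
      by (simp flip: of_nat_power of_nat_less_iff[where 'a = real])
    have P: "finite P" "\<And>p. p \<in> P \<Longrightarrow> prime p"
      unfolding P_def by (auto intro: finite_subset[of _ "{..nat \<lfloor>x\<rfloor>}"] simp: le_nat_floor)
    have K: "600 * real n powr (1/3) * (ln n)\<^sup>2 < real K"
      unfolding K_def N_def L_def by linarith
    define r where "r = (LEAST r. r \<in> (A - B) \<union> (B - A))"
    have "\<exists>r. r \<in> (A - B) \<union> (B - A)" using \<open>A \<noteq> B\<close> by auto
    then have "r \<in> (A - B) \<union> (B - A)"
      unfolding r_def by (rule LeastI_ex)
    moreover have below: "a \<in> A \<longleftrightarrow> a \<in> B" if "a < r" for a
      using not_less_Least[OF that[unfolded r_def]] by auto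
    ultimately have "\<exists>p\<in>P. \<exists>i<p. card (residue_part A i p) \<noteq> card (residue_part B i p)"
    proof (elim UnE DiffE)
      assume "r \<in> A" "r \<notin> B"
      then show ?thesis
        using separated_differing_residues[OF n A B sep _ _ below K P big] by blast
    next
      assume "r \<in> B" "r \<notin> A"
      then show ?thesis
        using separated_differing_residues[OF n B A sep(2,1) _ _ below [symmetric] K P big]
        by metis
    qed
    then obtain p i where "p \<in> P" "i < p" "card (residue_part A i p) \<noteq> card (residue_part B i p)"
      by blast
    then show ?thesis
      unfolding P_def x_def N_def L_def by (intro exI[of _ p]) (auto simp: mult.assoc)
  qed
  moreover have "C' > 0" using x0(1) by (simp add: C'_def)
  ultimately show ?thesis by blast
qed

end
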